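(* (Prime Orbit Theorem for lattice self-similar flows.) Let $\mathcal F_{\mathfrak w}$ be a lattice self-similar flow with weights $w_1\le\dots\le w_N$, generator $w$ and dimension $D$. Then $$\psi_{\mathfrak w}(x)=g_1(\log x)\,x^D-\frac1{N-1}\sum_{j=1}^Nw_j+O\left(x^{D-\alpha}\right)\quad\text{as }x\to\infty.$$ Here $D-\alpha$ is the abscissa of the first vertical line of complex dimensions next to $D$, and the periodic function $g_1$, of period $w$, is given by $$g_1(y)=\sum_{n=-\infty}^\infty\frac{e^{2\pi iny/w}}{D+2\pi in/w}=\frac{b_1w}{b_1-1}\,b_1^{-\{y/w\}},\qquad b_1=e^{wD}.$$ More precisely, let $\omega_1(=D),\omega_2,\dots,\omega_q$ be the finitely many complex dimensions (one for each distinct solution $z=e^{-w\omega}$ of the polynomial equation $\sum_jz^{k_j}=1$, with $k_j=w_j/w$) such that the set of complex dimensions is $\{\omega_u+2\pi in/w:n\in\mathbb Z,\ u=1,\dots,q\}$. Then $$\psi_{\mathfrak w}(x)=\sum_{u=1}^q-\operatorname{ord}(\zeta_{\mathfrak w};\omega_u)\sum_{n\in\mathbb Z}\frac{x^{\omega_u+2\pi in/w}}{\omega_u+2\pi in/w}-\frac1{N-1}\sum_{j=1}^Nw_j=\sum_{u=1}^q-\operatorname{ord}(\zeta_{\mathfrak w};\omega_u)\,g_u(\log x)\,x^{\omega_u}-\frac1{N-1}\sum_{j=1}^Nw_j,$$ where for each $u=1,\dots,q$, the function $g_u$ is periodic of period $w$, given by $$g_u(y)=\sum_{n\in\mathbb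 Z}\frac{e^{2\pi iny/w}}{\omega_u+2\pi in/w}=\frac{b_uw}{b_u-1}\,b_u^{-\{y/w\}},\qquad b_u=e^{w\omega_u},$$ and $\operatorname{ord}(\zeta_{\mathfrak w};\omega_1)=-1$.
   Context: Self-similar flow: $N\ge2$, $\Omega=\{1,\dots,N\}^{\mathbb N}$ with left shift $\sigma$, and a weight function $\mathfrak w:\Omega\to(0,\infty)$ depending only on the first letter: $\mathfrak w(a)=w_{a_1}$, where $0<w_1\le\dots\le w_N$. The flow is lattice if $\sum_{j=1}^N\mathbb Zw_j$ is not dense (hence discrete) in $\mathbb R$; then there are a unique $w>0$ (the generator) and positive integers $k_1\le\dots\le k_N$ without common divisor with $w_j=k_jw$. The dynamical zeta function is $\zeta_{\mathfrak w}(s)=\left(1-\sum_{j=1}^Ne^{-w_js}\right)^{-1}$, $s\in\mathbb C$. The complex dimensions are the poles of $-\zeta_{\mathfrak w}'/\zeta_{\mathfrak w}$ in $\mathbb C$, i.e. the solutions $\omega\in\mathbb C$ of $\sum_je^{-w_j\omega}=1$; they lie periodically, with period $2\pi i/w$, on finitely many vertical lines. The dimension $D>0$ is the unique real solution. $\operatorname{ord}(\zeta_{\mathfrak w};\omega)$ is the order of $\zeta_{\mathfrak w}$ at $\omega$ (negative at poles). For a periodic orbit $\mathfrak p$ of $\sigma$ (a finite set $\{a,\sigma a,\dots\}\subset\Omega$), $\mathfrak w_t(\mathfrak p)=\sum_{a\in\mathfrak p}\mathfrak w(a)$, and $$\psi_{\mathfrak w}(x)=\sum_{k\mathfrak w_t(\mathfrak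 p)\le\log x}\mathfrak w_t(\mathfrak p),$$ the sum over all pairs of a periodic orbit $\mathfrak p$ and an integer $k\ge1$ with $k\mathfrak w_t(\mathfrak p)\le\log x$. $\{u\}=u-[u]\in[0,1)$ is the fractional part of the real number $u$, $[u]$ being its integer part.
   Formalization: The series for g_u (symmetric partial sums) equals the closed form only for y/w not an integer; at integers, where equality fails, it is the mean of one-sided limits, and the series for ψ gives (ψ(x-)+ψ(x))/2. Exact formulas hold for x≥1 (series: x>1). With no next line, no error term. *)

theory Defs
  imports "HOL-Complex_Analysis.Complex_Analysis" "HOL-Library.Landau_Symbols"
begin

(* Letters are 1, ..., N; positions of a word are counted from 0, so the first letter of a is a 0. *)

definition words :: "nat \<Rightarrow> (nat \<Rightarrow> nat) set" where
  "words N = {a. \<forall>i. a i \<in> {1..N}}"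

definition shift :: "(nat \<Rightarrow> nat) \<Rightarrow> (nat \<Rightarrow> nat)" where
  "shift a = (\<lambda>i. a (Suc i))"

definition flow_weight :: "(nat \<Rightarrow> real) \<Rightarrow> (nat \<Rightarrow> nat) \<Rightarrow> real" where
  "flow_weight W a = W (a 0)"

(* Finiteness of the forward orbit alone would also admit preperiodic words. *)
definition periodic_orbits :: "nat \<Rightarrow> (nat \<Rightarrow> nat) set set" where
  "periodic_orbits N =
     {p. \<exists>a\<in>words N. (\<exists>n>0. (shift ^^ n) a = a) \<and> p = range (\<lambda>i. (shift ^^ i) a)}"

definition total_weight :: "(nat \<Rightarrow> real) \<Rightarrow> (nat \<Rightarrow> nat) set \<Rightarrow> real" where
  "total_weight W p = (\<Sum>a\<in>p. flow_weight W a)"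

definition orbit_psi :: "nat \<Rightarrow> (nat \<Rightarrow> real) \<Rightarrow> real \<Rightarrow> real" where
  "orbit_psi N W x =
     (\<Sum>(p, m)\<in>{(p, m::nat). p \<in> periodic_orbits N \<and> 1 \<le> m \<and> real m * total_weight W p \<le> ln x}.
        total_weight W p)"

definition lattice_weights :: "nat \<Rightarrow> (nat \<Rightarrow> real) \<Rightarrow> bool" where
  "lattice_weights N W \<longleftrightarrow>
     closure {\<Sum>j=1..N. of_int (c j) * W j | c :: nat \<Rightarrow> int. True} \<noteq> UNIV"

definition dyn_zeta :: "nat \<Rightarrow> (nat \<Rightarrow> real) \<Rightarrow> complex \<Rightarrow> complex" where
  "dyn_zeta N W s = inverse (1 - (\<Sum>j=1..N. exp (- (of_real (W j) * s))))"

definition complex_dimensions :: "nat \<Rightarrow> (nat \<Rightarrow> real) \<Rightarrow> complex set" where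
  "complex_dimensions N W =
     {\<omega>. is_pole (\<lambda>s. - deriv (dyn_zeta N W) s / dyn_zeta N W s) \<omega>}"

definition next_abscissa :: "nat \<Rightarrow> (nat \<Rightarrow> real) \<Rightarrow> real \<Rightarrow> real \<Rightarrow> bool" where
  "next_abscissa N W D \<beta> \<longleftrightarrow>
     \<beta> < D \<and> (\<exists>\<omega>\<in>complex_dimensions N W. Re \<omega> = \<beta>) \<and>
     (\<forall>\<omega>\<in>complex_dimensions N W. Re \<omega> < D \<longrightarrow> Re \<omega> \<le> \<beta>)"

definition dimension_reps ::
  "nat \<Rightarrow> (nat \<Rightarrow> nat) \<Rightarrow> real \<Rightarrow> real \<Rightarrow> nat \<Rightarrow> (nat \<Rightarrow> complex) \<Rightarrow> bool" where
  "dimension_reps N k w D q \<omega> \<longleftrightarrow>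
     1 \<le> q \<and> \<omega> 1 = of_real D \<and>
     bij_betw (\<lambda>u. exp (- (of_real w * \<omega> u))) {1..q} {z. (\<Sum>j=1..N. z ^ k j) = 1}"

(* Bilateral series are summed symmetrically: those below converge only conditionally. *)
definition bilateral_sums :: "(int \<Rightarrow> complex) \<Rightarrow> complex \<Rightarrow> bool" where
  "bilateral_sums f S \<longleftrightarrow> (\<lambda>T::nat. \<Sum>n\<in>{- int T..int T}. f n) \<longlonglongrightarrow> S"

definition shifted_dim :: "real \<Rightarrow> complex \<Rightarrow> int \<Rightarrow> complex" where
  "shifted_dim w \<omega> n = \<omega> + 2 * of_real pi * \<i> * of_int n / of_real w"

definition real_periodic_coeff :: "real \<Rightarrow> real \<Rightarrow> real \<Rightarrow> real" where
  "real_periodic_coeff w D y =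
     (let b = exp (w * D) in b * w / (b - 1) * b powr (- frac (y / w)))"

(* With b = exp (w \<omega>), the power b^(-t) means exp (- t w \<omega>), i.e. log b is taken to be w \<omega>.
   The principal branch would in general give a different value when \<bar>Im (w \<omega>)\<bar> > pi. *)
definition periodic_coeff :: "real \<Rightarrow> complex \<Rightarrow> real \<Rightarrow> complex" where
  "periodic_coeff w \<omega> y =
     (let b = exp (of_real w * \<omega>)
      in b * of_real w / (b - 1) * exp (- (of_real (frac (y / w)) * (of_real w * \<omega>))))"

(* g is given by the Fourier series
     \<Sum>n. exp (2 pi i n y / w) / (\<omega> + 2 pi i n / w):
   the series converges to g y where y / w is not an integer.  At the jumps of g, where y / w is an
   integer, a Fourier series converges to the mean of the two one-sided limits. *)
definition given_by_series :: "real \<Rightarrow> complex \<Rightarrow> (real \<Rightarrow> complex) \<Rightarrow> bool" where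
  "given_by_series w \<omega> g \<longleftrightarrow>
     (\<forall>y. y / w \<notin> \<int> \<longrightarrow>
        bilateral_sums
          (\<lambda>n. exp (2 * of_real pi * \<i> * of_int n * of_real y / of_real w) / shifted_dim w \<omega> n) (g y)) \<and>
     (\<forall>y. y / w \<in> \<int> \<longrightarrow>
        (\<exists>l r. (g \<longlongrightarrow> l) (at_left y) \<and> (g \<longlongrightarrow> r) (at_right y) \<and>
           bilateral_sums
             (\<lambda>n. exp (2 * of_real pi * \<i> * of_int n * of_real y / of_real w) / shifted_dim w \<omega> n)
             ((l + r) / 2)))"

end

theory Submission
  imports Defs "HOL-Computational_Algebra.Fundamental_Theorem_Algebra" "HOL-Real_Asymp.Real_Asymp"
begin

text \<open>
For lattice weights the explicit formula is a finite combinatorial identity. A periodic orbit \<open>p\<close>, a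
repetition number \<open>m\<close> and a base point in \<open>p\<close> together amount to a nonempty finite word, so \<open>\<psi> x\<close> is
the sum of the weights of the first letters of all nonempty words of weight at most \<open>ln x\<close>
(\<open>orbit_psi_eq_sum_words\<close>). Measure weights in units of \<open>w\<close> and put \<open>f = 1 - (\<Sum>j. X ^ k j)\<close>. The words
counted with the weight of the first letter have the generating function \<open>- X f' / f\<close>. By its partial
fraction expansion, the words of weight \<open>n\<close> contribute \<open>\<Sum>z. m z * z ^ (- n)\<close>, a sum over the roots \<open>z\<close>
of \<open>f\<close> with multiplicity \<open>m z\<close> (\<open>sum_counts_eq_power_sum\<close>). Consequently \<open>\<psi> x\<close> is a combination of geometric
sums with ratio \<open>1 / z = exp (w \<omega>)\<close>, truncated at \<open>\<lfloor>ln x / w\<rfloor>\<close>. The upper ends of these sums are the terms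
\<open>g (ln x) * x powr \<omega>\<close> of the formula (\<open>geometric_sum_eq_periodic_coeff\<close>), the integer part accounting for the
periodic factor \<open>g\<close>. The lower ends add up to a value of \<open>f' / f\<close>, which is the constant term
(\<open>sum_roots_at_one\<close>).

The zeta function is \<open>1 / f\<close> at \<open>z = exp (- w s)\<close>. As this substitution is locally injective, \<open>- m z\<close> is
the order of the zeta function (\<open>zorder_dyn_zeta\<close>). The positive root \<open>exp (- w D)\<close> is simple, and it is
strictly smaller in absolute value than every other root, because the \<open>k j\<close> have no common divisor
(\<open>dominant_root\<close>). This separates the leading term from the finitely many others, whose sum is of the
order of \<open>x\<close> to the largest real part among the remaining exponents.

It remains to identify the periodic coefficients with their Fourier series. Put \<open>c = w \<omega>\<close> and
\<open>t = frac (y / w)\<close>. Inside the unit interval, the increments in \<open>t\<close> of \<open>exp (c t)\<close> times the partial sums are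
integrals of a smooth function against an oscillation of growing frequency, and so tend to zero
(\<open>fourier_sum_interior_diff\<close>). The limit is thus a multiple of \<open>exp (- c t)\<close>. Its constant, like the value
of the series at the jumps, comes from the partial fraction expansion of the cotangent
(\<open>cot_partial_fractions\<close>).
\<close>

section \<open>Periodic orbits and finite words\<close>

lemma funpow_shift: "(shift ^^ n) a = (\<lambda>i. a (i + n))"
  by (induction n) (auto simp: shift_def)

definition orbit :: "(nat \<Rightarrow> nat) \<Rightarrow> (nat \<Rightarrow> nat) set" where
  "orbit a = range (\<lambda>i. (shift ^^ i) a)"

lemma self_in_orbit: "a \<in> orbit a"
  unfolding orbit_def by (metis funpow_0 rangeI)

lemma shift_mult_period:
  assumes "(shift ^^ n) a = a" shows "(shift ^^ (n * m)) a = a"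
  using assms by (induction m) (auto simp: funpow_add)

lemma shift_mod_period:
  assumes "(shift ^^ n) a = a" shows "(shift ^^ (i mod n)) a = (shift ^^ i) a"
proof -
  have "(shift ^^ i) a = (shift ^^ (i mod n + n * (i div n))) a" by simp
  also have "\<dots> = (shift ^^ (i mod n)) ((shift ^^ (n * (i div n))) a)"
    by (simp only: funpow_add o_apply)
  finally show ?thesis using shift_mult_period[OF assms] by simp
qed

text \<open>
The orbit of a periodic word is enumerated without repetition by the shifts below the minimal period,
so its cardinality is that period.
\<close>
lemma orbit_card:
  assumes "n > 0" "(shift ^^ n) a = a"
  shows "finite (orbit a)" "card (orbit a) > 0" "(shift ^^ card (orbit a)) a = a"
    "inj_on (\<lambda>i. (shift ^^ i) a) {..<card (orbit a)}"
    "orbit a = (\<lambda>i. (shift ^^ i) a) ` {..<card (orbit a)}"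
proof -
  define d where "d = (LEAST d. d > 0 \<and> (shift ^^ d) a = a)"
  have d: "d > 0" "(shift ^^ d) a = a"
    using LeastI[of "\<lambda>d. d > 0 \<and> (shift ^^ d) a = a" n] assms by (auto simp: d_def)
  have least: "\<not> (e > 0 \<and> (shift ^^ e) a = a)" if "e < d" for e
    using not_less_Least[of e "\<lambda>d. d > 0 \<and> (shift ^^ d) a = a"] that by (auto simp: d_def)
  have noteq: "(shift ^^ i) a \<noteq> (shift ^^ j) a" if "i < j" "j < d" for i j
  proof
    assume eq: "(shift ^^ i) a = (shift ^^ j) a"
    have "a = (shift ^^ (d - i + i)) a" using that d by simp
    also have "\<dots> = (shift ^^ (d - i)) ((shift ^^ j) a)" by (simp only: funpow_add o_apply eq)
    also have "\<dots> = (shift ^^ (j - i + d)) a"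
      using that by (simp flip: funpow_add o_apply[of "shift ^^ (d-i)"] add: add.commute)
    also have "\<dots> = (shift ^^ (j - i)) a" by (simp only: funpow_add o_apply d(2))
    finally have "(shift ^^ (j - i)) a = a" by simp
    moreover have "0 < j - i" "j - i < d" using that by linarith+
    ultimately show False using least[of "j - i"] by blast
  qed
  have inj: "inj_on (\<lambda>i. (shift ^^ i) a) {..<d}"
    by (rule inj_onI) (metis noteq lessThan_iff linorder_neqE_nat)
  have img: "orbit a = (\<lambda>i. (shift ^^ i) a) ` {..<d}"
  proof -
    have "(shift ^^ i) a \<in> (\<lambda>i. (shift ^^ i) a) ` {..<d}" for i
      using shift_mod_period[OF d(2), of i] d(1) by (intro image_eqI[of _ _ "i mod d"]) auto
    then show ?thesis unfolding orbit_def by auto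
  qed
  have card: "card (orbit a) = d" unfolding img using inj by (simp add: card_image)
  show "finite (orbit a)" "card (orbit a) > 0" "(shift ^^ card (orbit a)) a = a"
    "inj_on (\<lambda>i. (shift ^^ i) a) {..<card (orbit a)}"
    "orbit a = (\<lambda>i. (shift ^^ i) a) ` {..<card (orbit a)}"
    unfolding card using d inj img by auto
qed

lemma card_orbit_dvd:
  assumes "n > 0" "(shift ^^ n) a = a" shows "card (orbit a) dvd n"
proof -
  let ?d = "card (orbit a)"
  note oc = orbit_card[OF assms]
  have "(shift ^^ (n mod ?d)) a = (shift ^^ 0) a"
    using shift_mod_period[OF oc(3), of n] assms(2) by simp
  then have "n mod ?d = 0"
    using inj_onD[OF oc(4), of "n mod ?d" 0] oc(2) by simp
  then show ?thesis by auto
qed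

lemma orbit_of_member:
  assumes "n > 0" "(shift ^^ n) a = a" "b \<in> orbit a"
  shows "orbit b = orbit a" "(shift ^^ n) b = b"
proof -
  from assms(3) obtain i where b: "b = (shift ^^ i) a" unfolding orbit_def by auto
  show "(shift ^^ n) b = b"
  proof -
    have "(shift ^^ n) b = (shift ^^ i) ((shift ^^ n) a)"
      unfolding b by (simp flip: funpow_add o_apply[of "shift ^^ n"] o_apply[of "shift ^^ i"] add: add.commute)
    then show ?thesis using assms b by simp
  qed
  have "(shift ^^ j) a \<in> orbit b" for j
  proof -
    have "(shift ^^ j) a = (shift ^^ (j + n * i)) a"
      by (simp only: funpow_add o_apply shift_mult_period[OF assms(2)])
    also have "j + n * i = (j + n * i - i) + i" using assms(1) by (simp add: trans_le_add2)
    also have "(shift ^^ \<dots>) a = (shift ^^ (j + n * i - i)) b"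
      unfolding b by (simp only: funpow_add o_apply)
    finally show ?thesis unfolding orbit_def by auto
  qed
  moreover have "(shift ^^ j) b \<in> orbit a" for j
    unfolding b orbit_def by (metis funpow_add o_apply rangeI)
  ultimately show "orbit b = orbit a" unfolding orbit_def by auto
qed

lemma periodic_orbits_alt:
  "periodic_orbits N = {orbit a | a. a \<in> words N \<and> (\<exists>n>0. (shift ^^ n) a = a)}"
  unfolding periodic_orbits_def orbit_def by blast

lemma periodic_orbit_member:
  assumes "p \<in> periodic_orbits N" "a \<in> p"
  shows "a \<in> words N" "p = orbit a" "\<exists>n>0. (shift ^^ n) a = a"
proof -
  from assms(1) obtain b n where b: "b \<in> words N" "n > 0" "(shift ^^ n) b = b" "p = orbit b"
    unfolding periodic_orbits_alt by blast
  show "p = orbit a" "\<exists>n>0. (shift ^^ n) a = a"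
    using orbit_of_member[OF b(2,3)] b assms by auto
  from assms(2) b obtain i where "a = (shift ^^ i) b" unfolding orbit_def by auto
  with b(1) show "a \<in> words N" by (auto simp: words_def funpow_shift)
qed

lemma sum_weights_along_orbit:
  assumes "n > 0" "(shift ^^ n) a = a"
  shows "(\<Sum>i<m * card (orbit a). W (a i)) = real m * total_weight W (orbit a)"
proof -
  let ?d = "card (orbit a)"
  note oc = orbit_card[OF assms]
  have "total_weight W (orbit a) = (\<Sum>b\<in>(\<lambda>i. (shift ^^ i) a) ` {..<?d}. flow_weight W b)"
    unfolding total_weight_def using oc(5) by simp
  also have "\<dots> = (\<Sum>i<?d. W (a i))"
    using oc(4) by (subst sum.reindex) (auto simp: flow_weight_def funpow_shift)
  finally have tw: "total_weight W (orbit a) = (\<Sum>i<?d. W (a i))" .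
  have "(\<Sum>i<m * ?d. W (a i)) = (\<Sum>j<m. \<Sum>i\<in>{j * ?d..<j * ?d + ?d}. W (a i))"
    by (rule sum.nat_group[symmetric])
  also have "\<dots> = (\<Sum>j<m. \<Sum>i<?d. W (a i))"
  proof (rule sum.cong[OF refl])
    fix j
    have per: "a (i + j * ?d) = a i" for i
      using fun_cong[OF shift_mult_period[OF oc(3), of j], of i]
      by (simp add: funpow_shift mult.commute)
    have "(\<Sum>i\<in>{j * ?d..<j * ?d + ?d}. W (a i)) = (\<Sum>i\<in>{0 + j * ?d..<?d + j * ?d}. W (a i))"
      by (simp add: add.commute)
    also have "\<dots> = (\<Sum>i\<in>{0..<?d}. W (a (i + j * ?d)))" by (rule sum.shift_bounds_nat_ivl)
    also have "\<dots> = (\<Sum>i<?d. W (a i))" by (simp add: per atLeast0LessThan)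
    finally show "(\<Sum>i\<in>{j * ?d..<j * ?d + ?d}. W (a i)) = (\<Sum>i<?d. W (a i))" .
  qed
  finally show ?thesis by (simp add: tw)
qed

text \<open>
A nonempty finite word stands for the periodic word that repeats it, traversed once along the finite
word.
\<close>
definition closed_words :: "nat \<Rightarrow> (nat \<Rightarrow> real) \<Rightarrow> real \<Rightarrow> nat list set" where
  "closed_words N W T = {v. v \<noteq> [] \<and> set v \<subseteq> {1..N} \<and> sum_list (map W v) \<le> T}"

text \<open>
The total weight of an orbit \<open>p\<close> is the sum, over its points \<open>a\<close>, of the weight of the first letter
of \<open>a\<close>. Hence \<open>\<psi>\<close> sums first-letter weights over triples of an orbit, a repetition number \<open>m\<close> and a
base point. Reading off the first \<open>m * card p\<close> letters of the base point turns the triples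
bijectively into nonempty words. Conversely, a word \<open>v\<close> determines the base point as its periodic
extension, and \<open>m\<close> as the length of \<open>v\<close> divided by the period. Finiteness of the set of words is
transported back along the bijection, so that none of the sums degenerates to its default value.
\<close>
lemma orbit_psi_eq_sum_words:
  assumes fin: "finite (closed_words N W (ln x))"
  shows "orbit_psi N W x = (\<Sum>v\<in>closed_words N W (ln x). W (hd v))"
proof -
  define A where "A = {(p, m::nat). p \<in> periodic_orbits N \<and> 1 \<le> m \<and> real m * total_weight W p \<le> ln x}"
  define S where "S = (SIGMA pm:A. fst pm)"
  define enc where "enc = (\<lambda>((p::(nat \<Rightarrow> nat) set, m::nat), a::nat\<Rightarrow>nat). map a [0..<m * card p])"
  define per where "per = (\<lambda>(v::nat list) i::nat. v ! (i mod length v))"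
  define dec where "dec = (\<lambda>v. ((orbit (per v), length v div card (orbit (per v))), per v))"
  have enc: "enc s \<in> closed_words N W (ln x) \<and> dec (enc s) = s \<and> W (hd (enc s)) = flow_weight W (snd s)"
    if "s \<in> S" for s
  proof -
    obtain p m a where s: "s = ((p, m), a)" by (metis prod.exhaust)
    have p: "p \<in> periodic_orbits N" "1 \<le> m" "real m * total_weight W p \<le> ln x" "a \<in> p"
      using that by (auto simp: s S_def A_def)
    note pm = periodic_orbit_member[OF p(1,4)]
    from pm(3) obtain n where n: "n > 0" "(shift ^^ n) a = a" by auto
    note oc = orbit_card[OF n]
    let ?L = "m * card p"
    have L: "?L > 0" using p(2) oc(2) pm(2) by auto
    have shL: "(shift ^^ ?L) a = a" using shift_mult_period[OF oc(3), of m] pm(2) by (simp add: mult.commute)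
    have len: "length (enc s) = ?L" by (simp add: enc_def s)
    have "sum_list (map W (enc s)) = (\<Sum>i<?L. W (a i))"
      by (simp add: enc_def s comp_def interv_sum_list_conv_sum_set_nat atLeast0LessThan)
    also have "\<dots> \<le> ln x" using sum_weights_along_orbit[OF n, of W m] pm(2) p(3) by simp
    finally have 1: "enc s \<in> closed_words N W (ln x)"
      using pm(1) L by (auto simp: closed_words_def enc_def s words_def)
    have "per (enc s) = a"
    proof
      fix i
      have "i mod ?L < ?L" using L by simp
      then have "per (enc s) i = a (i mod ?L)" using len by (simp add: per_def enc_def s)
      then show "per (enc s) i = a i"
        using fun_cong[OF shift_mod_period[OF shL, of i], of 0] by (simp add: funpow_shift)
    qed
    then have 2: "dec (enc s) = s" using len pm(2) oc(2) by (simp add: dec_def s)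
    have "hd (enc s) = a 0" using L by (simp add: enc_def s hd_map)
    with 1 2 show ?thesis by (simp add: flow_weight_def s)
  qed
  have dec: "dec v \<in> S \<and> enc (dec v) = v" if "v \<in> closed_words N W (ln x)" for v
  proof -
    let ?a = "per v" let ?p = "orbit ?a" let ?m = "length v div card ?p"
    have v: "length v > 0" "set v \<subseteq> {1..N}" "sum_list (map W v) \<le> ln x"
      using that by (auto simp: closed_words_def)
    have sh: "(shift ^^ length v) ?a = ?a" by (auto simp: funpow_shift per_def)
    have "v ! (i mod length v) \<in> {1..N}" for i
      using v by (meson mod_less_divisor nth_mem subsetD)
    then have w: "?a \<in> words N" by (auto simp: words_def per_def)
    have p: "?p \<in> periodic_orbits N" unfolding periodic_orbits_alt using w sh v by blast
    have dv: "?m * card ?p = length v" using card_orbit_dvd[OF v(1) sh] by simp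
    then have m: "1 \<le> ?m" using v(1) by (cases ?m) auto
    have map: "map ?a [0..<length v] = v"
      by (rule nth_equalityI) (auto simp: per_def)
    have "real ?m * total_weight W ?p = (\<Sum>i<length v. W (?a i))"
      using sum_weights_along_orbit[OF v(1) sh, of W ?m] dv by simp
    also have "\<dots> = sum_list (map W (map ?a [0..<length v]))"
      by (simp add: comp_def interv_sum_list_conv_sum_set_nat atLeast0LessThan)
    also have "\<dots> \<le> ln x" using v map by simp
    finally show ?thesis using p m map dv self_in_orbit[of ?a] by (auto simp: dec_def S_def A_def enc_def)
  qed
  have bij: "bij_betw enc S (closed_words N W (ln x))"
    by (rule bij_betw_byWitness[where f' = dec]) (use enc dec in auto)
  have finS: "finite S" using bij fin bij_betw_finite by blast
  have ne: "fst pm \<noteq> {} \<and> finite (fst pm)" if "pm \<in> A" for pm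
  proof -
    have "fst pm \<in> periodic_orbits N" using that by (auto simp: A_def)
    then obtain b n where "n > 0" "(shift ^^ n) b = b" "fst pm = orbit b"
      unfolding periodic_orbits_alt by blast
    then show ?thesis using orbit_card(1)[of n b] self_in_orbit[of b] by auto
  qed
  have "A = fst ` S" using ne unfolding S_def by force
  then have finA: "finite A" using finS by simp
  have "orbit_psi N W x = (\<Sum>pm\<in>A. \<Sum>a\<in>fst pm. flow_weight W a)"
    unfolding orbit_psi_def A_def[symmetric] by (simp add: total_weight_def case_prod_beta)
  also have "\<dots> = (\<Sum>(pm, a)\<in>S. flow_weight W a)"
    unfolding S_def using finA ne by (subst sum.Sigma) auto
  also have "\<dots> = (\<Sum>s\<in>S. W (hd (enc s)))"
    using enc by (intro sum.cong) auto
  also have "\<dots> = (\<Sum>v\<in>closed_words N W (ln x). W (hd v))"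
    using sum.reindex_bij_betw[OF bij, of "\<lambda>v. W (hd v)"] .
  finally show ?thesis .
qed

definition weight_words :: "nat \<Rightarrow> (nat \<Rightarrow> nat) \<Rightarrow> nat \<Rightarrow> nat list set" where
  "weight_words N k n = {v. set v \<subseteq> {1..N} \<and> sum_list (map k v) = n}"

lemma finite_weight_words:
  assumes "\<forall>j\<in>{1..N}. 0 < k j" shows "finite (weight_words N k n)"
proof -
  have len: "length v \<le> sum_list (map k v)" if "set v \<subseteq> {1..N}" for v
    using that
  proof (induction v)
    case (Cons j v)
    then have "0 < k j" "length v \<le> sum_list (map k v)" using assms by auto
    then show ?case by simp
  qed simp
  have "weight_words N k n \<subseteq> {v. set v \<subseteq> {1..N} \<and> length v \<le> n}"
    using len by (auto simp: weight_words_def)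
  then show ?thesis using finite_lists_length_le[of "{1..N}" n] finite_subset by auto
qed

text \<open>
Splitting off the first letter. With \<open>g = 1\<close> this is the recurrence for the number of words of a
given weight, and with \<open>g = k\<close> it expresses the coefficients of \<open>\<psi>\<close> through these numbers.
\<close>
lemma sum_weight_words_hd:
  fixes g :: "nat \<Rightarrow> 'a :: comm_semiring_1"
  assumes k: "\<forall>j\<in>{1..N}. 0 < k j" and n: "n > 0"
  shows "(\<Sum>v\<in>weight_words N k n. g (hd v)) =
    (\<Sum>j=1..N. if k j \<le> n then g j * of_nat (card (weight_words N k (n - k j))) else 0)"
proof -
  let ?J = "{j\<in>{1..N}. k j \<le> n}"
  have cons: "j # v \<in> weight_words N k n \<longleftrightarrow> j \<in> ?J \<and> v \<in> weight_words N k (n - k j)" for j v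
    by (auto simp: weight_words_def)
  have split: "hd v # tl v = v" if "v \<in> weight_words N k n" for v
    using that n by (cases v) (auto simp: weight_words_def)
  have mem: "hd v \<in> ?J \<and> tl v \<in> weight_words N k (n - k (hd v))" if "v \<in> weight_words N k n" for v
    using cons[of "hd v" "tl v"] split[OF that] that by simp
  have "(\<Sum>v\<in>weight_words N k n. g (hd v)) =
    (\<Sum>(j, v)\<in>(SIGMA j:?J. weight_words N k (n - k j)). g j)"
    by (rule sum.reindex_bij_witness[where i = "\<lambda>(j, v). j # v" and j = "\<lambda>v. (hd v, tl v)"])
       (use mem in \<open>auto simp: cons split\<close>)
  also have "\<dots> = (\<Sum>j\<in>?J. \<Sum>v\<in>weight_words N k (n - k j). g j)"
    using finite_weight_words[OF k] by (subst sum.Sigma) auto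
  also have "\<dots> = (\<Sum>j\<in>?J. g j * of_nat (card (weight_words N k (n - k j))))"
    by (simp add: mult.commute)
  also have "\<dots> = (\<Sum>j=1..N. if k j \<le> n then g j * of_nat (card (weight_words N k (n - k j))) else 0)"
    by (rule sum.inter_filter) simp
  finally show ?thesis .
qed

lemma orbit_psi_eq_sum_counts:
  assumes k: "\<forall>j\<in>{1..N}. 0 < k j" and W: "\<forall>j\<in>{1..N}. W j = real (k j) * w"
    and w: "0 < w" and x: "1 \<le> x"
  shows "orbit_psi N W x = w * (\<Sum>n=1..nat \<lfloor>ln x / w\<rfloor>. \<Sum>v\<in>weight_words N k n. real (k (hd v)))"
proof -
  let ?M = "nat \<lfloor>ln x / w\<rfloor>"
  have wt: "sum_list (map W v) = real (sum_list (map k v)) * w" if "set v \<subseteq> {1..N}" for v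
    using that W by (induction v) (auto simp: algebra_simps)
  have pos: "v \<noteq> [] \<longleftrightarrow> 1 \<le> sum_list (map k v)" if "set v \<subseteq> {1..N}" for v
    using that k by (cases v) force+
  have le: "real n * w \<le> ln x \<longleftrightarrow> n \<le> ?M" for n
  proof -
    have "real n * w \<le> ln x \<longleftrightarrow> real n \<le> ln x / w" using w by (simp add: field_simps)
    also have "\<dots> \<longleftrightarrow> int n \<le> \<lfloor>ln x / w\<rfloor>" by (simp add: le_floor_iff)
    also have "\<dots> \<longleftrightarrow> n \<le> ?M" using x w by (simp add: le_nat_iff)
    finally show ?thesis .
  qed
  have cw: "closed_words N W (ln x) = (\<Union>n\<in>{1..?M}. weight_words N k n)"
  proof -
    have "v \<in> closed_words N W (ln x) \<longleftrightarrow> v \<in> (\<Union>n\<in>{1..?M}. weight_words N k n)" for v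
      unfolding closed_words_def weight_words_def using wt[of v] pos[of v] le by auto
    then show ?thesis by blast
  qed
  have "orbit_psi N W x = (\<Sum>v\<in>(\<Union>n\<in>{1..?M}. weight_words N k n). W (hd v))"
    using orbit_psi_eq_sum_words[of N W x] finite_weight_words[OF k] unfolding cw by simp
  also have "\<dots> = (\<Sum>n=1..?M. \<Sum>v\<in>weight_words N k n. W (hd v))"
    by (rule sum.UNION_disjoint) (use finite_weight_words[OF k] in \<open>auto simp: weight_words_def\<close>)
  also have "\<dots> = (\<Sum>n=1..?M. \<Sum>v\<in>weight_words N k n. w * real (k (hd v)))"
  proof (intro sum.cong refl)
    fix n v assume "n \<in> {1..?M}" "v \<in> weight_words N k n"
    then have "hd v \<in> {1..N}" unfolding weight_words_def by (cases v) auto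
    then show "W (hd v) = w * real (k (hd v))" using W by simp
  qed
  finally show ?thesis by (simp add: sum_distrib_left)
qed

section \<open>Counting words by weight\<close>

text \<open>
In the variable \<open>z = exp (- w s)\<close>, this is the reciprocal of the dynamical zeta function.
\<close>
definition weight_poly :: "nat \<Rightarrow> (nat \<Rightarrow> nat) \<Rightarrow> complex poly" where
  "weight_poly N k = 1 - (\<Sum>j=1..N. monom 1 (k j))"

lemma poly_weight_poly: "poly (weight_poly N k) z = 1 - (\<Sum>j=1..N. z ^ k j)"
  by (simp add: weight_poly_def poly_sum poly_monom)

lemma weight_poly_0:
  assumes "\<forall>j\<in>{1..N}. 0 < k j" shows "poly (weight_poly N k) 0 = 1"
  using assms by (auto simp: poly_weight_poly intro!: sum.neutral)

lemma weight_poly_nonzero: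
  assumes "\<forall>j\<in>{1..N}. 0 < k j" shows "weight_poly N k \<noteq> 0"
  using weight_poly_0[OF assms] by auto

lemma pderiv_weight_poly:
  "pderiv (weight_poly N k) = - (\<Sum>j=1..N. monom (of_nat (k j)) (k j - 1))"
  by (simp add: weight_poly_def pderiv_diff pderiv_monom higher_pderiv_sum[of 1, simplified])

text \<open>
The partial fraction expansion of \<open>f' / f\<close>, multiplied by \<open>f\<close> and thus an identity of polynomials.
In this form it can be evaluated at a point as well as read as an identity of power series; both
are needed. The polynomial \<open>h z\<close> is the quotient of \<open>f\<close> by \<open>X - z\<close>.
\<close>
lemma pderiv_eq_sum_roots:
  fixes f :: "complex poly"
  assumes "f \<noteq> 0"
  obtains h where "\<And>z. poly f z = 0 \<Longrightarrow> [:-z, 1:] * h z = f"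
    and "pderiv f = (\<Sum>z | poly f z = 0. smult (of_nat (order z f)) (h z))"
proof -
  define S where "S = {z. poly f z = 0}"
  have S: "finite S" unfolding S_def using assms by (rule poly_roots_finite)
  define h where "h z = f div [:-z, 1:]" for z
  have h: "[:-z, 1:] * h z = f" if "poly f z = 0" for z
    unfolding h_def using that by (metis dvd_mult_div_cancel poly_eq_0_iff_dvd)
  define F where "F z = [:-z, 1:] ^ order z f" for z
  have f: "f = smult (lead_coeff f) (\<Prod>z\<in>S. F z)"
    unfolding F_def S_def by (rule complex_poly_decompose[symmetric])
  have *: "smult (lead_coeff f) (prod F (S - {z}) * pderiv (F z)) = smult (of_nat (order z f)) (h z)"
    if z: "z \<in> S" for z
  proof -
    have "order z f > 0" using z assms by (auto simp: S_def order_root)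
    then obtain n where n: "order z f = Suc n" by (cases "order z f") auto
    have "[:-z, 1:] * pderiv (F z) = smult (of_nat (order z f)) (F z)"
      unfolding F_def n pderiv_power_Suc by (simp add: pderiv_pCons algebra_simps)
    then have "[:-z, 1:] * smult (lead_coeff f) (prod F (S - {z}) * pderiv (F z))
        = smult (lead_coeff f) (prod F (S - {z}) * smult (of_nat (order z f)) (F z))"
      by (metis mult.left_commute mult_smult_right)
    also have "\<dots> = smult (of_nat (order z f)) (smult (lead_coeff f) (prod F S))"
      by (subst prod.remove[OF S z]) (simp add: mult_ac)
    also have "\<dots> = [:-z, 1:] * smult (of_nat (order z f)) (h z)"
      using h[of z] z by (simp only: f[symmetric]) (simp add: S_def)
    finally show ?thesis by (subst (asm) mult_left_cancel) auto
  qed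
  have "pderiv f = smult (lead_coeff f) (\<Sum>z\<in>S. prod F (S - {z}) * pderiv (F z))"
    by (subst f) (simp add: pderiv_smult pderiv_prod)
  also have "\<dots> = (\<Sum>z\<in>S. smult (of_nat (order z f)) (h z))"
  proof -
    have "smult (lead_coeff f) (sum g S) = (\<Sum>z\<in>S. smult (lead_coeff f) (g z))" for g
      by (induction S rule: infinite_finite_induct) (auto simp: smult_add_right)
    also have "(\<Sum>z\<in>S. smult (lead_coeff f) (prod F (S - {z}) * pderiv (F z)))
        = (\<Sum>z\<in>S. smult (of_nat (order z f)) (h z))"
      by (rule sum.cong[OF refl *])
    finally show ?thesis .
  qed
  finally show ?thesis using that h unfolding S_def by blast
qed

text \<open>
With \<open>f = 1 - (\<Sum>j. X ^ k j)\<close>, the words counted by weight have the generating function \<open>C = 1 / f\<close>, and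
the words counted with the weight of their first letter have \<open>Q = - X f' / f\<close>. The partial fraction
expansion of the latter is \<open>\<Sum>z. m z * X / (z - X)\<close>, summed over the roots \<open>z\<close> with multiplicity \<open>m z\<close>;
\<open>G z\<close> below is the power series of \<open>X / (z - X)\<close>.
\<close>
lemma sum_counts_eq_power_sum:
  assumes k: "\<forall>j\<in>{1..N}. 0 < k j" and n: "n > 0"
  shows "(\<Sum>v\<in>weight_words N k n. of_nat (k (hd v))) =
    (\<Sum>z | poly (weight_poly N k) z = 0. of_nat (order z (weight_poly N k)) * inverse z ^ n)"
proof -
  let ?f = "weight_poly N k" let ?R = "{z. poly ?f z = 0}"
  define C :: "complex fps" where "C = Abs_fps (\<lambda>n. of_nat (card (weight_words N k n)))"
  define Q :: "complex fps" where
    "Q = Abs_fps (\<lambda>n. if n = 0 then 0 else (\<Sum>v\<in>weight_words N k n. of_nat (k (hd v))))"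
  define G :: "complex \<Rightarrow> complex fps" where "G z = Abs_fps (\<lambda>n. if n = 0 then 0 else inverse z ^ n)" for z
  obtain h where h: "\<And>z. poly ?f z = 0 \<Longrightarrow> [:-z, 1:] * h z = ?f"
    and df: "pderiv ?f = (\<Sum>z\<in>?R. smult (of_nat (order z ?f)) (h z))"
    using pderiv_eq_sum_roots[OF weight_poly_nonzero[OF k]] by blast
  have pf: "fps_of_poly ?f = 1 - (\<Sum>j=1..N. fps_X ^ k j)"
    by (simp add: weight_poly_def fps_of_poly_diff fps_of_poly_sum fps_of_poly_monom)
  have pdf: "fps_X * fps_of_poly (pderiv ?f) = - (\<Sum>j=1..N. of_nat (k j) * fps_X ^ k j)"
  proof -
    have "fps_X * fps_of_poly (monom (of_nat (k j)) (k j - 1)) = (of_nat (k j) * fps_X ^ k j :: complex fps)"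
      if "j \<in> {1..N}" for j
      using k that by (simp add: fps_of_poly_monom power_eq_if fps_of_nat flip: fps_of_nat)
    then show ?thesis
      by (simp add: pderiv_weight_poly fps_of_poly_uminus fps_of_poly_sum sum_distrib_left)
  qed
  have w0: "weight_words N k 0 = {[]}"
  proof -
    have "v = []" if "v \<in> weight_words N k 0" for v
      using that k by (cases v) (force simp: weight_words_def)+
    then show ?thesis by (auto simp: weight_words_def)
  qed
  have "C = 1 + (\<Sum>j=1..N. fps_X ^ k j) * C"
  proof (rule fps_ext)
    fix n show "C $ n = (1 + (\<Sum>j=1..N. fps_X ^ k j) * C) $ n"
    proof (cases "n = 0")
      case True
      then show ?thesis using k by (auto intro!: sum.neutral simp: C_def w0 sum_distrib_right fps_sum_nth fps_X_power_mult_nth)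
    next
      case False
      then show ?thesis
        using sum_weight_words_hd[OF k, of n "\<lambda>_. 1::complex"]
        by (simp add: C_def sum_distrib_right fps_sum_nth fps_X_power_mult_nth if_distrib not_less cong: if_cong)
          (auto intro!: sum.cong)
    qed
  qed
  then have fC: "fps_of_poly ?f * C = 1" unfolding pf by (simp add: algebra_simps)
  have "Q = (\<Sum>j=1..N. of_nat (k j) * fps_X ^ k j) * C"
  proof (rule fps_ext)
    fix n show "Q $ n = ((\<Sum>j=1..N. of_nat (k j) * fps_X ^ k j) * C) $ n"
    proof (cases "n = 0")
      case True
      then show ?thesis using k
        by (auto intro!: sum.neutral simp: Q_def sum_distrib_right fps_sum_nth fps_X_power_mult_nth mult.assoc
          fps_of_nat[symmetric])
    next
      case False
      then show ?thesis
        using sum_weight_words_hd[OF k, of n "\<lambda>j. of_nat (k j) :: complex"]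
        by (simp add: Q_def C_def sum_distrib_right fps_sum_nth fps_X_power_mult_nth mult.assoc not_less flip: fps_of_nat)
          (auto intro!: sum.cong)
    qed
  qed
  then have "fps_of_poly ?f * Q = - (fps_X * fps_of_poly (pderiv ?f)) * (fps_of_poly ?f * C)"
    unfolding pdf by (simp add: algebra_simps)
  then have Q: "fps_of_poly ?f * Q = - (fps_X * fps_of_poly (pderiv ?f))" by (simp add: fC)
  have G: "fps_of_poly ?f * G z = - (fps_X * fps_of_poly (h z))" if z: "z \<in> ?R" for z
  proof -
    have "z \<noteq> 0" using z weight_poly_0[OF k] by auto
    have "(fps_X - fps_const z) * G z = - fps_X"
    proof (rule fps_ext)
      fix n show "((fps_X - fps_const z) * G z) $ n = (- fps_X) $ n"
      proof (cases n)
        case (Suc m)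
        then show ?thesis using \<open>z \<noteq> 0\<close>
          by (cases m) (simp_all add: G_def left_diff_distrib fps_X_def[symmetric])
      qed (simp add: G_def left_diff_distrib)
    qed
    moreover have "fps_of_poly [:-z, 1:] = fps_X - fps_const z"
      by (simp add: fps_of_poly_pCons fps_const_neg[symmetric] del: fps_const_neg)
    ultimately have lin: "fps_of_poly [:-z, 1:] * G z = - fps_X" by (simp only:)
    have "fps_of_poly ?f = fps_of_poly ([:-z, 1:] * h z)" using h[of z] z by simp
    also have "\<dots> = fps_of_poly [:-z, 1:] * fps_of_poly (h z)" by (rule fps_of_poly_mult)
    finally have "fps_of_poly ?f * G z = (fps_of_poly [:-z, 1:] * G z) * fps_of_poly (h z)"
      by (simp only: mult_ac)
    also have "\<dots> = - (fps_X * fps_of_poly (h z))" unfolding lin by simp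
    finally show ?thesis .
  qed
  have "fps_of_poly ?f * (\<Sum>z\<in>?R. fps_const (of_nat (order z ?f)) * G z)
      = (\<Sum>z\<in>?R. fps_const (of_nat (order z ?f)) * (fps_of_poly ?f * G z))"
    by (simp add: sum_distrib_left mult_ac)
  also have "\<dots> = (\<Sum>z\<in>?R. fps_const (of_nat (order z ?f)) * - (fps_X * fps_of_poly (h z)))"
    using G by simp
  also have "\<dots> = - (fps_X * fps_of_poly (pderiv ?f))"
    unfolding df by (simp add: fps_of_poly_sum fps_of_poly_smult sum_distrib_left sum_negf mult_ac)
  finally have "fps_of_poly ?f * Q = fps_of_poly ?f * (\<Sum>z\<in>?R. fps_const (of_nat (order z ?f)) * G z)"
    using Q by simp
  moreover have "fps_of_poly ?f \<noteq> 0" using fC by auto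
  ultimately have "Q = (\<Sum>z\<in>?R. fps_const (of_nat (order z ?f)) * G z)" by simp
  then have "Q $ n = (\<Sum>z\<in>?R. fps_const (of_nat (order z ?f)) * G z) $ n" by simp
  then show ?thesis using n by (simp add: Q_def G_def fps_sum_nth)
qed

lemma root_weight_poly:
  assumes N: "2 \<le> N" and k: "\<forall>j\<in>{1..N}. 0 < k j" and z: "poly (weight_poly N k) z = 0"
  shows "z \<noteq> 0" "z \<noteq> 1"
proof -
  show "z \<noteq> 0" using z weight_poly_0[OF k] by auto
  have "poly (weight_poly N k) 1 = 1 - of_nat N" by (simp add: poly_weight_poly)
  also have "\<dots> \<noteq> 0" using N by (metis numeral_le_one_iff of_nat_1 of_nat_eq_iff right_minus_eq semiring_norm(69))
  finally show "z \<noteq> 1" using z by auto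
qed

text \<open>
Both sides are \<open>f' / f\<close> at \<open>1\<close>. This sum collects the lower ends of the geometric sums of
\<open>orbit_psi_eq_power_sums\<close> and gives the constant term of \<open>\<psi>\<close>.
\<close>
lemma sum_roots_at_one:
  assumes N: "2 \<le> N" and k: "\<forall>j\<in>{1..N}. 0 < k j"
  shows "(\<Sum>z | poly (weight_poly N k) z = 0. of_nat (order z (weight_poly N k)) / (1 - z))
    = (\<Sum>j=1..N. of_nat (k j)) / (of_nat N - 1)"
proof -
  let ?f = "weight_poly N k" let ?R = "{z. poly ?f z = 0}"
  obtain h where h: "\<And>z. poly ?f z = 0 \<Longrightarrow> [:-z, 1:] * h z = ?f"
    and df: "pderiv ?f = (\<Sum>z\<in>?R. smult (of_nat (order z ?f)) (h z))"
    using pderiv_eq_sum_roots[OF weight_poly_nonzero[OF k]] by blast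
  have f1: "poly ?f 1 = 1 - of_nat N" by (simp add: poly_weight_poly)
  have N1: "(of_nat N :: complex) \<noteq> 1" using N by auto
  have h1: "poly (h z) 1 = (1 - of_nat N) / (1 - z)" if "z \<in> ?R" for z
  proof -
    have "poly ([:-z, 1:] * h z) 1 = poly ?f 1" using h that by simp
    then have "(1 - z) * poly (h z) 1 = 1 - of_nat N" by (simp only: f1 poly_mult) (simp add: algebra_simps)
    then show ?thesis using root_weight_poly(2)[OF N k, of z] that by (auto simp: field_simps)
  qed
  have "(1 - of_nat N) * (\<Sum>z\<in>?R. of_nat (order z ?f) / (1 - z)) = poly (pderiv ?f) 1"
    unfolding df by (simp add: poly_sum h1 sum_distrib_left mult_ac)
  also have "\<dots> = - (\<Sum>j=1..N. of_nat (k j))"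
    by (simp add: pderiv_weight_poly poly_sum poly_monom)
  finally show ?thesis using N1 by (simp add: field_simps)
qed

lemma orbit_psi_eq_power_sums:
  assumes k: "\<forall>j\<in>{1..N}. 0 < k j" and W: "\<forall>j\<in>{1..N}. W j = real (k j) * w"
    and w: "0 < w" and x: "1 \<le> x"
  shows "complex_of_real (orbit_psi N W x) = (\<Sum>z | poly (weight_poly N k) z = 0.
    of_nat (order z (weight_poly N k)) * (of_real w * (\<Sum>n=1..nat \<lfloor>ln x / w\<rfloor>. inverse z ^ n)))"
proof -
  let ?f = "weight_poly N k" let ?R = "{z. poly ?f z = 0}" let ?M = "nat \<lfloor>ln x / w\<rfloor>"
  have "complex_of_real (orbit_psi N W x)
      = of_real w * (\<Sum>n=1..?M. \<Sum>v\<in>weight_words N k n. of_nat (k (hd v)))"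
    unfolding orbit_psi_eq_sum_counts[OF assms] by simp
  also have "\<dots> = of_real w * (\<Sum>n=1..?M. \<Sum>z\<in>?R. of_nat (order z ?f) * inverse z ^ n)"
    using sum_counts_eq_power_sum[OF k] by simp
  also have "\<dots> = of_real w * (\<Sum>z\<in>?R. \<Sum>n=1..?M. of_nat (order z ?f) * inverse z ^ n)"
    by (subst sum.swap) simp
  also have "\<dots> = (\<Sum>z\<in>?R. of_nat (order z ?f) * (of_real w * (\<Sum>n=1..?M. inverse z ^ n)))"
    by (simp add: sum_distrib_left mult_ac)
  finally show ?thesis .
qed

text \<open>
With \<open>M = \<lfloor>ln x / w\<rfloor>\<close>, the power \<open>b ^ M\<close> is \<open>x powr \<omega>\<close> times \<open>b\<close> to the power \<open>- frac (ln x / w)\<close>. The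
truncation at an integer is what makes the coefficient of \<open>x powr \<omega>\<close> periodic in \<open>ln x\<close>.
\<close>
lemma geometric_sum_eq_periodic_coeff:
  assumes w: "0 < w" and x: "1 \<le> x" and z: "exp (- (of_real w * \<omega>)) = z" "z \<noteq> 1"
  shows "of_real w * (\<Sum>n=1..nat \<lfloor>ln x / w\<rfloor>. inverse z ^ n)
    = periodic_coeff w \<omega> (ln x) * of_real x powr \<omega> - of_real w / (1 - z)"
proof -
  define b where "b = inverse z"
  define M where "M = nat \<lfloor>ln x / w\<rfloor>"
  have b: "b = exp (of_real w * \<omega>)" unfolding b_def z(1)[symmetric] by (simp add: exp_minus)
  have b01: "b \<noteq> 0" "b \<noteq> 1" using b z(2) by (auto simp: b_def)
  have zb: "z = 1 / b" by (simp add: b_def field_simps)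
  have M: "ln x / w = real M + frac (ln x / w)"
    unfolding M_def frac_def using w x by simp
  have "of_real x powr \<omega> = exp (\<omega> * of_real (ln x))"
    using x by (simp add: powr_def Ln_of_real)
  also have "ln x = w * (real M + frac (ln x / w))" using M w by (simp add: field_simps)
  also have "exp (\<omega> * of_real \<dots>) = exp (of_real w * \<omega>) ^ M * exp (of_real (frac (ln x / w)) * (of_real w * \<omega>))"
    by (simp add: exp_add[symmetric] exp_of_nat_mult[symmetric] algebra_simps)
  finally have pw: "periodic_coeff w \<omega> (ln x) * of_real x powr \<omega> = b * of_real w / (b - 1) * b ^ M"
    unfolding periodic_coeff_def Let_def b[symmetric] using b01(2) by (simp add: exp_minus)
  have "(\<Sum>n=1..M. b ^ n) = (b * b ^ M - b) / (b - 1)"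
  proof (induction M)
    case (Suc M)
    then show ?case using b01 by (simp add: field_simps)
  qed simp
  then have "of_real w * (\<Sum>n=1..M. b ^ n) = b * of_real w / (b - 1) * b ^ M - of_real w * (b / (b - 1))"
    by (simp add: diff_divide_distrib right_diff_distrib mult_ac)
  also have "b / (b - 1) = 1 / (1 - z)" unfolding zb using b01 by (simp add: field_simps)
  finally show ?thesis using pw unfolding M_def b_def by simp
qed

section \<open>Orders of the zeta function and the dominant root\<close>

lemma dyn_zeta_eq_poly:
  assumes W: "\<forall>j\<in>{1..N}. W j = real (k j) * w"
  shows "dyn_zeta N W = (\<lambda>s. inverse (poly (weight_poly N k) (exp (- (of_real w * s)))))"
proof
  fix s :: complex
  have "exp (- (of_real (W j) * s)) = exp (- (of_real w * s)) ^ k j" if "j \<in> {1..N}" for j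
    using W that by (simp add: exp_of_nat_mult[symmetric] mult_ac)
  then show "dyn_zeta N W s = inverse (poly (weight_poly N k) (exp (- (of_real w * s))))"
    by (simp add: dyn_zeta_def poly_weight_poly)
qed

lemma zorder_poly:
  assumes "p \<noteq> 0" shows "zorder (poly p) z = int (order z p)"
proof -
  obtain q where q: "p = [:-z, 1:] ^ order z p * q" "\<not> [:-z, 1:] dvd q"
    using order_decomp[OF assms] by blast
  show ?thesis
  proof (rule zorder_eqI[where S = UNIV and g = "poly q"])
    show "poly q z \<noteq> 0" using q(2) by (simp add: poly_eq_0_iff_dvd)
    fix s show "poly p s = poly q s * (s - z) powi int (order z p)"
      by (subst q(1)) (simp add: poly_power)
  qed (auto intro: holomorphic_intros)
qed

lemma eventually_neq_of_deriv_nonzero: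
  fixes g :: "complex \<Rightarrow> complex"
  assumes "(g has_field_derivative D) (at z)" "D \<noteq> 0"
  shows "eventually (\<lambda>s. g s \<noteq> g z) (at z)"
proof -
  have "((\<lambda>s. (g s - g z) / (s - z)) \<longlongrightarrow> D) (at z)"
    using assms(1) by (simp add: has_field_derivative_iff)
  then have "eventually (\<lambda>s. (g s - g z) / (s - z) \<noteq> 0) (at z)"
    using assms(2) by (rule tendsto_imp_eventually_ne)
  then show ?thesis by eventually_elim auto
qed

lemma eventually_poly_nonzero:
  fixes p :: "complex poly"
  assumes "p \<noteq> 0" shows "eventually (\<lambda>s. poly p s \<noteq> 0) (at z)"
proof -
  have "finite ({s. poly p s = 0} - {z})" using poly_roots_finite[OF assms] by simp
  then have "eventually (\<lambda>s. s \<in> - ({s. poly p s = 0} - {z})) (nhds z)"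
    by (intro eventually_nhds_in_open open_Compl finite_imp_closed) simp_all
  then show ?thesis unfolding eventually_at_filter by eventually_elim auto
qed

text \<open>
The derivative of \<open>s \<mapsto> exp (- w s)\<close> vanishes nowhere, so the substitution preserves orders.
\<close>
lemma
  fixes p :: "complex poly" and w :: real
  assumes "p \<noteq> 0" "w \<noteq> 0"
  defines "G \<equiv> \<lambda>s. poly p (exp (- (of_real w * s)))"
  shows eventually_poly_exp_nonzero: "eventually (\<lambda>s. G s \<noteq> 0) (at \<omega>)"
    and zorder_poly_exp: "zorder G \<omega> = int (order (exp (- (of_real w * \<omega>))) p)"
    and analytic_poly_exp: "G analytic_on A"
proof -
  define E :: "complex \<Rightarrow> complex" where "E = (\<lambda>s. exp (- (of_real w * s)))"
  have G: "G = poly p \<circ> E" by (auto simp: G_def E_def)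
  have an: "poly p analytic_on B" "E analytic_on B" for B
  proof -
    have "poly p holomorphic_on UNIV" by (auto intro: holomorphic_intros)
    then show "poly p analytic_on B" using analytic_on_open analytic_on_subset by blast
    show "E analytic_on B" unfolding E_def by (auto intro!: analytic_intros)
  qed
  show "G analytic_on A" unfolding G by (rule analytic_on_compose[OF an(2) an(1)])
  have D: "(E has_field_derivative (- of_real w * E \<omega>)) (at \<omega>)"
    unfolding E_def by (auto intro!: derivative_eq_intros)
  have neq: "eventually (\<lambda>s. E s \<noteq> E \<omega>) (at \<omega>)"
    by (rule eventually_neq_of_deriv_nonzero[OF D]) (use assms in \<open>auto simp: E_def\<close>)
  have "filterlim E (at (E \<omega>)) (at \<omega>)"
    using neq DERIV_isCont[OF D] by (auto simp: filterlim_at isCont_def)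
  then show "eventually (\<lambda>s. G s \<noteq> 0) (at \<omega>)"
    using eventually_poly_nonzero[OF assms(1), of "E \<omega>"] unfolding G o_def filterlim_iff by blast
  have "zorder G \<omega> = zorder (poly p) (E \<omega>) * zorder (\<lambda>s. E s - E \<omega>) \<omega>"
    unfolding G
    by (rule zorder_compose')
      (use an neq eventually_poly_nonzero[OF assms(1)] in
        \<open>auto intro: isolated_singularity_at_analytic not_essential_analytic\<close>)
  also have "zorder (\<lambda>s. E s - E \<omega>) \<omega> = 1"
  proof (rule zorder_zero_eqI')
    have "((\<lambda>s. E s - E \<omega>) has_field_derivative (- of_real w * E \<omega>)) (at \<omega>)"
      using D by (auto intro!: derivative_eq_intros)
    then show "(deriv ^^ nat 1) (\<lambda>s. E s - E \<omega>) \<omega> \<noteq> 0"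
      using assms by (simp add: DERIV_imp_deriv E_def)
  qed (auto intro!: analytic_intros an)
  finally show "zorder G \<omega> = int (order (exp (- (of_real w * \<omega>))) p)"
    using assms by (simp add: zorder_poly E_def)
qed

lemma zorder_dyn_zeta:
  assumes k: "\<forall>j\<in>{1..N}. 0 < k j" and W: "\<forall>j\<in>{1..N}. W j = real (k j) * w" and w: "0 < w"
  shows "zorder (dyn_zeta N W) \<omega> = - int (order (exp (- (of_real w * \<omega>))) (weight_poly N k))"
proof -
  note f = weight_poly_nonzero[OF k] and w' = less_imp_neq[OF w, symmetric]
  show ?thesis unfolding dyn_zeta_eq_poly[OF W]
    using analytic_poly_exp[OF f w', of "{\<omega>}"] eventually_poly_exp_nonzero[OF f w', of \<omega>] zorder_poly_exp[OF f w', of \<omega>]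
    by (subst zorder_inverse)
      (auto intro!: isolated_singularity_at_analytic not_essential_analytic eventually_frequently)
qed

text \<open>
The logarithmic derivative has a pole at every zero of \<open>1 / \<zeta>\<close>, whatever its multiplicity, and is
analytic everywhere else.
\<close>
lemma complex_dimensions_eq:
  assumes k: "\<forall>j\<in>{1..N}. 0 < k j" and W: "\<forall>j\<in>{1..N}. W j = real (k j) * w" and w: "0 < w"
  shows "complex_dimensions N W = {\<omega>. poly (weight_poly N k) (exp (- (of_real w * \<omega>))) = 0}"
proof -
  note f = weight_poly_nonzero[OF k] and w' = less_imp_neq[OF w, symmetric]
  define G where "G = (\<lambda>s. poly (weight_poly N k) (exp (- (of_real w * s))))"
  have zeta: "dyn_zeta N W = (\<lambda>s. inverse (G s))" unfolding G_def by (rule dyn_zeta_eq_poly[OF W])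
  have an: "G analytic_on A" for A unfolding G_def by (rule analytic_poly_exp[OF f w'])
  have nz: "eventually (\<lambda>s. G s \<noteq> 0) (at \<omega>)" for \<omega>
    unfolding G_def by (rule eventually_poly_exp_nonzero[OF f w'])
  have "is_pole (\<lambda>s. - deriv (dyn_zeta N W) s / dyn_zeta N W s) \<omega> \<longleftrightarrow> G \<omega> = 0" for \<omega>
  proof
    assume pole: "is_pole (\<lambda>s. - deriv (dyn_zeta N W) s / dyn_zeta N W s) \<omega>"
    show "G \<omega> = 0"
    proof (rule ccontr)
      assume ne: "G \<omega> \<noteq> 0"
      then have "dyn_zeta N W analytic_on {\<omega>}" unfolding zeta by (auto intro!: analytic_intros an)
      then have "(\<lambda>s. - deriv (dyn_zeta N W) s / dyn_zeta N W s) analytic_on {\<omega>}"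
        using ne by (auto intro!: analytic_intros analytic_deriv simp: zeta)
      then show False using pole analytic_at_imp_no_pole by blast
    qed
  next
    assume "G \<omega> = 0"
    then have "isolated_zero G \<omega>"
      using nz[of \<omega>] analytic_at_imp_isCont[OF an, of \<omega>] by (auto simp: isolated_zero_def isCont_def)
    then have pole: "is_pole (dyn_zeta N W) \<omega>" unfolding zeta by (simp add: is_pole_inverse_iff)
    have "isolated_singularity_at (dyn_zeta N W) \<omega>"
      unfolding zeta by (intro singularity_intros isolated_singularity_at_analytic not_essential_analytic an)
    then have "is_pole (\<lambda>s. - (deriv (dyn_zeta N W) s / dyn_zeta N W s)) \<omega>"
      unfolding is_pole_uminus_iff using pole by (rule is_pole_deriv_divide_is_pole)
    then show "is_pole (\<lambda>s. - deriv (dyn_zeta N W) s / dyn_zeta N W s) \<omega>" by simp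
  qed
  then show ?thesis unfolding complex_dimensions_def G_def by blast
qed

text \<open>
The exponents \<open>a\<close> with \<open>u ^ a = 1\<close> are the multiples of one number, which then divides their common
divisor \<open>1\<close>.
\<close>
lemma power_Gcd_eq_1:
  fixes u :: complex and A :: "nat set"
  assumes "\<forall>a\<in>A. u ^ a = 1" "Gcd A = 1" shows "u = 1"
proof -
  \<comment> \<open>The value \<open>0\<close> stands for the absence of a positive exponent; then only \<open>a = 0\<close> gives \<open>1\<close>.\<close>
  define n where "n = (if \<exists>n>0. u ^ n = 1 then (LEAST n. n > 0 \<and> u ^ n = 1) else 0)"
  have n: "n dvd a" if "u ^ a = 1" for a
  proof (cases "a = 0")
    case False
    then have ex: "\<exists>n>0. u ^ n = 1" using that by auto
    then have n0: "n > 0" "u ^ n = 1"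
      using LeastI_ex[of "\<lambda>n. n > 0 \<and> u ^ n = 1"] by (auto simp: n_def)
    have "u ^ (a mod n) = u ^ (a mod n) * (u ^ n) ^ (a div n)" using n0 by simp
    also have "\<dots> = u ^ a" by (simp flip: power_mult power_add)
    finally have 1: "u ^ (a mod n) = 1" using that by simp
    have "a mod n < n" using n0 by simp
    then have "\<not> (a mod n > 0 \<and> u ^ (a mod n) = 1)"
      using not_less_Least[of "a mod n" "\<lambda>n. n > 0 \<and> u ^ n = 1"] ex by (simp add: n_def)
    then show ?thesis using 1 by auto
  qed simp
  have "n dvd Gcd A" using n assms(1) by (auto intro: Gcd_greatest)
  then have "n = 1" using assms(2) by simp
  then have "\<exists>n>0. u ^ n = 1" by (metis n_def zero_neq_one)
  then have "u ^ n = 1" using LeastI_ex[of "\<lambda>n. n > 0 \<and> u ^ n = 1"] by (auto simp: n_def)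
  then show ?thesis using \<open>n = 1\<close> by simp
qed

text \<open>
If \<open>\<bar>z\<bar> \<le> r\<close>, then the real parts of the terms of \<open>\<Sum>j. z ^ k j = 1\<close> are at most the terms of
\<open>\<Sum>j. r ^ k j = 1\<close>, so they agree term by term, which forces \<open>z ^ k j = r ^ k j\<close>. Since the \<open>k j\<close> have no
common divisor, \<open>z = r\<close>. Thus \<open>D\<close> is the only complex dimension, up to the period, on its vertical line
and to the right of it.
\<close>
lemma dominant_root:
  fixes z :: complex and r :: real
  assumes k: "\<forall>j\<in>{1..N}. 0 < k j" and gcd: "Gcd (k ` {1..N}) = 1"
    and r: "0 < r" "(\<Sum>j=1..N. r ^ k j) = 1"
    and z: "poly (weight_poly N k) z = 0" "norm z \<le> r"
  shows "z = of_real r"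
proof -
  have le: "Re (z ^ k j) \<le> r ^ k j" for j
  proof -
    have "Re (z ^ k j) \<le> norm z ^ k j" by (metis complex_Re_le_cmod norm_power)
    also have "\<dots> \<le> r ^ k j" using z by (intro power_mono) auto
    finally show ?thesis .
  qed
  have "(\<Sum>j=1..N. z ^ k j) = 1" using z(1) by (simp add: poly_weight_poly)
  then have "(\<Sum>j=1..N. Re (z ^ k j)) = 1" by (metis Re_sum one_complex.simps(1))
  then have "(\<Sum>j=1..N. r ^ k j - Re (z ^ k j)) = 0" using r by (simp add: sum_subtractf)
  then have eq: "\<forall>j\<in>{1..N}. Re (z ^ k j) = r ^ k j"
    using le by (subst (asm) sum_nonneg_eq_0_iff) auto
  have "(z / of_real r) ^ k j = 1" if j: "j \<in> {1..N}" for j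
  proof -
    have "norm (z ^ k j) \<le> r ^ k j" using z by (simp add: norm_power power_mono)
    then have "(norm (z ^ k j))\<^sup>2 \<le> (r ^ k j)\<^sup>2" by (rule power_mono) simp
    then have "(Im (z ^ k j))\<^sup>2 \<le> 0" unfolding cmod_power2 using eq j by simp
    then have "z ^ k j = of_real (r ^ k j)"
      using eq j by (intro complex_eqI) (simp_all del: of_real_power)
    then show ?thesis using r by (simp add: power_divide)
  qed
  then have "z / of_real r = 1" using gcd by (intro power_Gcd_eq_1[of "k ` {1..N}"]) auto
  then show ?thesis using r by simp
qed

text \<open>
The derivative of the weight polynomial at \<open>r > 0\<close> is a sum of negative terms.
\<close>
lemma order_dominant_root:
  fixes r :: real
  assumes N: "1 \<le> N" and k: "\<forall>j\<in>{1..N}. 0 < k j"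
    and r: "0 < r" "(\<Sum>j=1..N. r ^ k j) = 1"
  shows "order (of_real r) (weight_poly N k) = 1"
proof -
  let ?f = "weight_poly N k"
  have "poly ?f (of_real r) = 1 - of_real (\<Sum>j=1..N. r ^ k j)" by (simp add: poly_weight_poly)
  then have root: "poly ?f (of_real r) = 0" unfolding r(2) by simp
  have "poly (pderiv ?f) (of_real r) = - of_real (\<Sum>j=1..N. real (k j) * r ^ (k j - 1))"
    by (simp add: pderiv_weight_poly poly_sum poly_monom)
  moreover have "(\<Sum>j=1..N. real (k j) * r ^ (k j - 1)) > 0"
    using N k r by (intro sum_pos) auto
  ultimately have "poly (pderiv ?f) (of_real r) \<noteq> 0" by (metis neg_equal_0_iff_equal of_real_eq_0_iff less_irrefl)
  moreover from this have "pderiv ?f \<noteq> 0" by auto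
  ultimately show ?thesis
    using order_pderiv[of ?f "of_real r"] root weight_poly_nonzero[OF k]
    by (metis One_nat_def order_root order_0I)
qed

section \<open>The Fourier series of the periodic coefficients\<close>

lemma sum_symmetric_Suc:
  fixes g :: "int \<Rightarrow> 'a :: comm_monoid_add"
  shows "(\<Sum>n\<in>{- int (Suc T)..int (Suc T)}. g n)
    = (\<Sum>n\<in>{- int T..int T}. g n) + g (int (Suc T)) + g (- int (Suc T))"
proof -
  have eq: "{- int (Suc T)..int (Suc T)} = insert (int (Suc T)) (insert (- int (Suc T)) {- int T..int T})"
    by auto
  show ?thesis unfolding eq by (simp add: add_ac)
qed

text \<open>
Digamma is a limit of \<open>ln m - (\<Sum>n<m. 1 / (z + n))\<close>. In the difference of its values at \<open>z\<close> and \<open>- z\<close> the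
logarithms cancel and the symmetric partial sums remain. The value of that difference is the
logarithmic derivative of the reflection formula for \<open>1 / \<Gamma>\<close>.
\<close>
lemma cot_partial_fractions:
  fixes z :: complex
  assumes z: "z \<notin> \<int>"
  shows "(\<lambda>T. \<Sum>n\<in>{- int T..int T}. 1 / (z + of_int n)) \<longlonglongrightarrow> of_real pi * cot (of_real pi * z)"
proof -
  have z0: "z \<noteq> 0" using z by auto
  have np: "z \<notin> \<int>\<^sub>\<le>\<^sub>0" "- z \<notin> \<int>\<^sub>\<le>\<^sub>0"
    using z nonpos_Ints_Int by (blast, metis minus_in_Ints_iff nonpos_Ints_Int)
  have sin: "sin (of_real pi * z) \<noteq> 0"
  proof
    assume "sin (of_real pi * z) = 0"
    then obtain n where "of_real pi * z = of_real (of_int n * pi)" by (auto simp: sin_eq_0)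
    then have "z = of_int n" by simp
    with z show False by simp
  qed
  have lim: "(\<lambda>T. of_real (ln (real (Suc T))) - (\<Sum>n<Suc T. inverse (a + of_nat n))) \<longlonglongrightarrow> Digamma a"
    if "a \<noteq> 0" for a :: complex
    using LIMSEQ_Suc[OF Digamma_LIMSEQ[OF that]] .
  have "(\<lambda>T. (\<Sum>n<Suc T. inverse (z + of_nat n)) - (\<Sum>n<Suc T. inverse (- z + of_nat n)) - 1 / z)
      \<longlonglongrightarrow> Digamma (- z) - Digamma z - 1 / z"
  proof (rule Lim_transform_eventually, rule tendsto_diff[OF tendsto_diff[OF lim lim] tendsto_const])
    show "- z \<noteq> 0" "z \<noteq> 0" using z0 by auto
  qed (simp add: always_eventually)
  also have "(\<lambda>T. (\<Sum>n<Suc T. inverse (z + of_nat n)) - (\<Sum>n<Suc T. inverse (- z + of_nat n)) - 1 / z)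
     = (\<lambda>T. \<Sum>n\<in>{- int T..int T}. 1 / (z + of_int n))"
  proof
    fix T
    show "(\<Sum>n<Suc T. inverse (z + of_nat n)) - (\<Sum>n<Suc T. inverse (- z + of_nat n)) - 1 / z
      = (\<Sum>n\<in>{- int T..int T}. 1 / (z + of_int n))"
    proof (induction T)
      case 0
      then show ?case using z0 by (simp add: field_simps)
    next
      case (Suc T)
      have "inverse (- z + of_nat (Suc T)) = - (1 / (z + of_int (- int (Suc T))))"
        by (metis (no_types, opaque_lifting) add_uminus_conv_diff inverse_eq_divide minus_diff_eq
            minus_divide_right of_int_minus of_int_of_nat_eq uminus_add_conv_diff)
      moreover have "inverse (z + of_nat (Suc T)) = 1 / (z + of_int (int (Suc T)))"
        by (simp add: inverse_eq_divide)
      ultimately show ?case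
        unfolding sum_symmetric_Suc Suc.IH[symmetric] sum.lessThan_Suc[of _ "Suc T"]
        by simp
    qed
  qed
  also have "Digamma (- z) - Digamma z - 1 / z = of_real pi * cot (of_real pi * z)"
  proof -
    have "((\<lambda>s. rGamma s * rGamma (- s)) has_field_derivative
        (rGamma z * rGamma (- z) * (Digamma (- z) - Digamma z))) (at z)"
      using np by (auto intro!: derivative_eq_intros simp: algebra_simps)
    moreover have "((\<lambda>s. rGamma s * rGamma (- s)) has_field_derivative
        (- (sin (of_real pi * z) / of_real pi) - z * cos (of_real pi * z))) (at z)"
      unfolding rGamma_reflection_complex'
      by (auto intro!: derivative_eq_intros simp: field_simps)
    ultimately have "rGamma z * rGamma (- z) * (Digamma (- z) - Digamma z)
        = - (sin (of_real pi * z) / of_real pi) - z * cos (of_real pi * z)"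
      by (rule DERIV_unique)
    then have eq: "- z * sin (of_real pi * z) / of_real pi * (Digamma (- z) - Digamma z)
        = - (sin (of_real pi * z) / of_real pi) - z * cos (of_real pi * z)"
      unfolding rGamma_reflection_complex' .
    have "Digamma (- z) - Digamma z
        = (- (sin (of_real pi * z) / of_real pi) - z * cos (of_real pi * z)) / (- z * sin (of_real pi * z) / of_real pi)"
      unfolding eq[symmetric] using sin z0 by simp
    also have "\<dots> = 1 / z + of_real pi * cot (of_real pi * z)"
      using sin z0 by (simp add: cot_def divide_simps)
    finally show ?thesis by simp
  qed
  finally show ?thesis .
qed

text \<open>
The Fourier series of \<open>t \<mapsto> exp (c (1 - t)) / (exp c - 1)\<close> on the unit interval, to which the series of
the theorem reduce with \<open>c = w \<omega>\<close> and \<open>t = frac (y / w)\<close>.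
\<close>
definition fourier_term :: "complex \<Rightarrow> real \<Rightarrow> int \<Rightarrow> complex" where
  "fourier_term c t n = exp (2 * of_real pi * \<i> * of_int n * of_real t) / (c + 2 * of_real pi * \<i> * of_int n)"

lemma exp_neq_1_imp_nonzero:
  assumes "exp c \<noteq> 1" shows "c + 2 * of_real pi * \<i> * of_int n \<noteq> 0"
proof
  assume "c + 2 * of_real pi * \<i> * of_int n = 0"
  then have "c = of_int (2 * - n) * of_real pi * \<i>" by (simp add: add_eq_0_iff algebra_simps)
  then have "exp c = exp (of_int (2 * - n) * of_real pi * \<i>)" by (rule arg_cong)
  also have "\<dots> = 1" unfolding exp_eq_1 by (auto intro!: exI[of _ "- n"])
  finally show False using assms by simp
qed

lemma fourier_sum_at_0:
  assumes c: "exp c \<noteq> 1"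
  shows "(\<lambda>T. \<Sum>n\<in>{- int T..int T}. fourier_term c 0 n) \<longlonglongrightarrow> (exp c + 1) / (2 * (exp c - 1))"
proof -
  define E where "E = exp (c / 2)"
  have E: "exp c = E ^ 2" "E \<noteq> 0" by (simp_all add: E_def exp_double[symmetric])
  define z where "z = c / (2 * of_real pi * \<i>)"
  have cz: "c = 2 * of_real pi * \<i> * z" by (simp add: z_def)
  have "z \<notin> \<int>"
  proof
    assume "z \<in> \<int>"
    then obtain n where "z = of_int n" by (auto elim: Ints_cases)
    then have "c + 2 * of_real pi * \<i> * of_int (- n) = 0" using cz by simp
    then show False using exp_neq_1_imp_nonzero[OF c] by blast
  qed
  from tendsto_mult_left[OF cot_partial_fractions[OF this], of "1 / (2 * of_real pi * \<i>)"]
  have "(\<lambda>T. \<Sum>n\<in>{- int T..int T}. fourier_term c 0 n)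
      \<longlonglongrightarrow> 1 / (2 * of_real pi * \<i>) * (of_real pi * cot (of_real pi * z))"
  proof (rule Lim_transform_eventually, intro always_eventually allI)
    fix T
    have "1 / (2 * of_real pi * \<i>) * (1 / (z + of_int n)) = fourier_term c 0 n" for n
      unfolding fourier_term_def cz by (simp add: distrib_left[symmetric])
    then show "1 / (2 * of_real pi * \<i>) * (\<Sum>n\<in>{- int T..int T}. 1 / (z + of_int n))
        = (\<Sum>n\<in>{- int T..int T}. fourier_term c 0 n)"
      by (simp add: sum_distrib_left)
  qed
  also have "1 / (2 * of_real pi * \<i>) * (of_real pi * cot (of_real pi * z)) = (exp c + 1) / (2 * (exp c - 1))"
  proof -
    have "\<i> * (of_real pi * z) = c / 2" by (simp add: cz)
    then have "cos (of_real pi * z) = (E + inverse E) / 2" "sin (of_real pi * z) = (E - inverse E) / (2 * \<i>)"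
      unfolding cos_exp_eq sin_exp_eq \<open>\<i> * (of_real pi * z) = c / 2\<close> by (simp_all add: E_def exp_minus)
    then have "1 / (2 * of_real pi * \<i>) * (of_real pi * cot (of_real pi * z))
        = (E + inverse E) / (2 * (E - inverse E))"
      by (simp add: cot_def)
    also have "\<dots> = (E * (E + inverse E)) / (E * (2 * (E - inverse E)))" using E by simp
    also have "\<dots> = (E ^ 2 + 1) / (2 * (E ^ 2 - 1))" using E by (simp add: algebra_simps power2_eq_square)
    finally show ?thesis by (simp add: E)
  qed
  finally show ?thesis .
qed

lemma sum_even_symmetric:
  "(\<Sum>n\<in>{- int T..int T}. if even n then g n else 0) = (\<Sum>m\<in>{- int (T div 2)..int (T div 2)}. g (2 * m))"
proof -
  have "(\<Sum>n\<in>{- int T..int T}. if even n then g n else 0) = (\<Sum>n\<in>{n\<in>{- int T..int T}. even n}. g n)"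
    by (rule sum.inter_filter[symmetric]) simp
  also have "\<dots> = (\<Sum>m\<in>{- int (T div 2)..int (T div 2)}. g (2 * m))"
    by (rule sum.reindex_bij_witness[where i = "\<lambda>m. 2 * m" and j = "\<lambda>n. n div 2"]) auto
  finally show ?thesis .
qed

text \<open>
At \<open>t = 1/2\<close> the terms alternate in sign. Adding the series at \<open>t = 0\<close> leaves twice the terms of even
index, and these form the series at \<open>0\<close> for \<open>c / 2\<close>.
\<close>
lemma fourier_sum_at_half:
  assumes c: "exp c \<noteq> 1"
  shows "(\<lambda>T. \<Sum>n\<in>{- int T..int T}. fourier_term c (1/2) n) \<longlonglongrightarrow> exp (c / 2) / (exp c - 1)"
proof -
  define E where "E = exp (c / 2)"
  have E: "exp c = E ^ 2" by (simp_all add: E_def exp_double[symmetric])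
  have E1: "E \<noteq> 1" "E ^ 2 \<noteq> 1" using c E by auto
  have c2: "exp (c / 2) \<noteq> 1" using E1 E_def by simp
  have trm: "fourier_term c (1/2) n = (if even n then fourier_term (c / 2) 0 (n div 2) else 0) - fourier_term c 0 n" for n
  proof (cases "even n")
    case True
    then obtain m where m: "n = 2 * m" by auto
    have "exp (2 * of_real pi * \<i> * of_int n * of_real (1/2)) = exp (of_int (2 * m) * of_real pi * \<i>)"
      by (simp add: m mult_ac)
    also have "\<dots> = 1" unfolding exp_eq_1 by auto
    finally have "fourier_term c (1/2) n = fourier_term c 0 n" by (simp add: fourier_term_def)
    moreover have "fourier_term (c / 2) 0 m = 2 * fourier_term c 0 n"
    proof -
      define X where "X = c / 2 + 2 * of_real pi * \<i> * of_int m"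
      have "c + 2 * of_real pi * \<i> * of_int n = 2 * X"
        by (simp add: m X_def algebra_simps)
      then show ?thesis unfolding fourier_term_def X_def[symmetric] by simp
    qed
    ultimately show ?thesis by (simp add: m)
  next
    case False
    then obtain m where m: "n = 2 * m + 1" by (elim oddE)
    have "exp (2 * of_real pi * \<i> * of_int n * of_real (1/2)) = exp (of_int (2 * m) * of_real pi * \<i> + of_real pi * \<i>)"
      by (simp add: m algebra_simps)
    also have "\<dots> = exp (of_int (2 * m) * of_real pi * \<i>) * exp (of_real pi * \<i>)" by (rule exp_add)
    also have "exp (of_int (2 * m) * of_real pi * \<i>) = 1" unfolding exp_eq_1 by auto
    finally show ?thesis using False by (simp add: fourier_term_def)
  qed
  have sums: "(\<Sum>n\<in>{- int T..int T}. fourier_term c (1/2) n) =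
     (\<Sum>n\<in>{- int (T div 2)..int (T div 2)}. fourier_term (c / 2) 0 n) - (\<Sum>n\<in>{- int T..int T}. fourier_term c 0 n)" for T
    unfolding trm sum_subtractf sum_even_symmetric by simp
  have "filterlim (\<lambda>T. T div 2) sequentially (sequentially :: nat filter)"
    unfolding filterlim_at_top eventually_sequentially
  proof
    show "\<exists>N. \<forall>n\<ge>N. Z \<le> n div 2" for Z :: nat by (rule exI[of _ "2 * Z"]) auto
  qed
  then have "(\<lambda>T. \<Sum>n\<in>{- int (T div 2)..int (T div 2)}. fourier_term (c / 2) 0 n)
      \<longlonglongrightarrow> (exp (c / 2) + 1) / (2 * (exp (c / 2) - 1))"
    using fourier_sum_at_0[OF c2] by (rule filterlim_compose[rotated])
  from tendsto_diff[OF this fourier_sum_at_0[OF c]]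
  have "(\<lambda>T. \<Sum>n\<in>{- int T..int T}. fourier_term c (1/2) n)
     \<longlonglongrightarrow> (E + 1) / (2 * (E - 1)) - (E ^ 2 + 1) / (2 * (E ^ 2 - 1))"
    unfolding sums E_def[symmetric] E .
  also have "(E + 1) / (2 * (E - 1)) = (E + 1) ^ 2 / (2 * (E ^ 2 - 1))"
  proof -
    have "E + 1 \<noteq> 0" using E1 by (metis add_eq_0_iff2 power2_minus power_one)
    moreover have "E ^ 2 - 1 = (E - 1) * (E + 1)" by (simp add: algebra_simps power2_eq_square)
    ultimately show ?thesis by (simp add: power2_eq_square)
  qed
  also have "(E + 1) ^ 2 / (2 * (E ^ 2 - 1)) - (E ^ 2 + 1) / (2 * (E ^ 2 - 1)) = (2 * E) / (2 * (E ^ 2 - 1))"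
    by (simp add: diff_divide_distrib[symmetric] power2_eq_square algebra_simps)
  also have "\<dots> = E / (E ^ 2 - 1)" by (rule mult_divide_mult_cancel_left) simp
  also have "\<dots> = exp (c / 2) / (exp c - 1)" unfolding E unfolding E_def ..
  finally show ?thesis .
qed

lemma dirichlet_kernel:
  fixes s :: complex
  shows "(\<Sum>n\<in>{- int T..int T}. exp (2 * of_real pi * \<i> * of_int n * s)) * sin (of_real pi * s)
    = sin (of_nat (2 * T + 1) * of_real pi * s)"
proof (induction T)
  case (Suc T)
  let ?x = "of_nat (2 * T + 2) * of_real pi * s"
  have "exp (2 * of_real pi * \<i> * of_int (int (Suc T)) * s) + exp (2 * of_real pi * \<i> * of_int (- int (Suc T)) * s)
      = 2 * cos ?x"
    unfolding cos_exp_eq by (simp add: algebra_simps)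
  then have "(\<Sum>n\<in>{- int (Suc T)..int (Suc T)}. exp (2 * of_real pi * \<i> * of_int n * s)) * sin (of_real pi * s)
     = sin (of_nat (2 * T + 1) * of_real pi * s) + 2 * cos ?x * sin (of_real pi * s)"
    unfolding sum_symmetric_Suc Suc.IH[symmetric] by (simp add: algebra_simps)
  also have "of_nat (2 * T + 1) * of_real pi * s = ?x - of_real pi * s" by (simp add: algebra_simps)
  also have "sin (?x - of_real pi * s) + 2 * cos ?x * sin (of_real pi * s) = sin (?x + of_real pi * s)"
    by (simp add: sin_diff sin_add)
  also have "?x + of_real pi * s = of_nat (2 * Suc T + 1) * of_real pi * s" by (simp add: algebra_simps)
  finally show ?case .
qed simp

text \<open>
The derivative in \<open>t\<close> of \<open>exp (c t)\<close> times the partial sum is \<open>exp (c t)\<close> times the Dirichlet kernel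
\<open>sin ((2T + 1) \<pi> t) / sin (\<pi> t)\<close>, because the differentiation cancels the denominators. It oscillates
with frequency \<open>L = (2T + 1) \<pi>\<close>. Adding \<open>u cos (L t) / L\<close>, where \<open>u = exp (c t) / sin (\<pi> t)\<close>, removes
the kernel up to a term of order \<open>1 / L\<close>; this amounts to an integration by parts without integrals.
Between \<open>1/2\<close> and \<open>t\<close> the sine has no zero, so all bounds are uniform there. The functions are taken
on the complex plane, in order to use the mean value inequality for complex derivatives along the
segment.
\<close>
lemma fourier_sum_interior_diff:
  assumes c: "exp c \<noteq> 1" and t: "0 < t" "t < 1"
  shows "(\<lambda>T. exp (c * of_real t) * (\<Sum>n\<in>{- int T..int T}. fourier_term c t n)
     - exp (c / 2) * (\<Sum>n\<in>{- int T..int T}. fourier_term c (1/2) n)) \<longlonglongrightarrow> 0"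
proof -
  define K where "K = closed_segment (1/2) (complex_of_real t)"
  have K: "\<exists>r. s = of_real r \<and> 0 < r \<and> r < 1" if "s \<in> K" for s
  proof -
    from that have "s \<in> of_real ` closed_segment (1/2) t"
      unfolding K_def using closed_segment_of_real[of "1/2" t, where ?'a = complex] by simp
    then show ?thesis using t by (auto simp: closed_segment_eq_real_ivl split: if_splits)
  qed
  have sinK: "sin (of_real pi * s) \<noteq> 0" if "s \<in> K" for s
  proof -
    obtain r where r: "s = of_real r" "0 < r" "r < 1" using K[OF \<open>s \<in> K\<close>] by blast
    then have "sin (pi * r) > 0" by (intro sin_gt_zero) auto
    then show ?thesis unfolding r by (metis less_irrefl of_real_eq_0_iff of_real_mult sin_of_real)
  qed
  define u where "u s = exp (c * s) / sin (of_real pi * s)" for s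
  define u' where "u' s = (c * exp (c * s) * sin (of_real pi * s) - exp (c * s) * (of_real pi * cos (of_real pi * s)))
      / (sin (of_real pi * s))^2" for s
  have du: "(u has_field_derivative u' s) (at s within K)" if "s \<in> K" for s
    unfolding u_def u'_def using sinK[OF that]
    by (auto intro!: derivative_eq_intros simp: power2_eq_square mult_ac)
  have "continuous_on K u'" unfolding u'_def using sinK by (intro continuous_intros) auto
  then have "compact (u' ` K)" by (intro compact_continuous_image) (auto simp: K_def)
  then obtain B where B: "\<And>s. s \<in> K \<Longrightarrow> norm (u' s) \<le> B"
    using compact_imp_bounded bounded_iff by (metis imageI)
  define L :: "nat \<Rightarrow> complex" where "L T = of_nat (2 * T + 1) * of_real pi" for T
  have L0: "L T \<noteq> 0" for T unfolding L_def by (simp del: of_nat_add of_nat_mult of_nat_Suc)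
  have nL: "norm (L T) = real (2 * T + 1) * pi" for T unfolding L_def norm_mult by (simp del: of_nat_add of_nat_mult of_nat_Suc)
  define F where "F T s = exp (c * s) * (\<Sum>n\<in>{- int T..int T}. exp (2 * of_real pi * \<i> * of_int n * s) / (c + 2 * of_real pi * \<i> * of_int n))"
    for T s
  define H where "H T s = F T s + u s * cos (L T * s) / L T" for T s
  have cosK: "norm (cos (L T * s)) \<le> 1" if "s \<in> K" for s T
  proof -
    obtain r where "s = of_real r" using K[OF \<open>s \<in> K\<close>] by blast
    then have "cos (L T * s) = of_real (cos (real (2 * T + 1) * pi * r))"
      unfolding L_def cos_of_real[symmetric] by simp
    then show ?thesis by (simp only: norm_of_real abs_cos_le_one)
  qed
  have dF: "(F T has_field_derivative exp (c * s) * (\<Sum>n\<in>{- int T..int T}. exp (2 * of_real pi * \<i> * of_int n * s))) (at s within K)" for T s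
  proof -
    let ?e = "\<lambda>n s. exp (2 * of_real pi * \<i> * of_int n * s)" let ?q = "\<lambda>n. c + 2 * of_real pi * \<i> * of_int n"
    have "((\<lambda>s. \<Sum>n\<in>{- int T..int T}. exp (c * s) * ?e n s / ?q n) has_field_derivative (\<Sum>n\<in>{- int T..int T}. exp (c * s) * ?e n s)) (at s within K)"
    proof (rule DERIV_sum)
      fix n
      have "((\<lambda>s. exp (c * s) * ?e n s) has_field_derivative (exp (c * s) * ?e n s * ?q n)) (at s within K)"
        by (auto intro!: derivative_eq_intros simp: algebra_simps)
      from DERIV_cdivide[OF this, of "?q n"]
      show "((\<lambda>s. exp (c * s) * ?e n s / ?q n) has_field_derivative exp (c * s) * ?e n s) (at s within K)"
        using exp_neq_1_imp_nonzero[OF c, of n] by simp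
    qed
    then show ?thesis unfolding F_def by (simp add: sum_distrib_left)
  qed
  have dH: "(H T has_field_derivative u' s * cos (L T * s) / L T) (at s within K)" if s: "s \<in> K" for T s
  proof -
    have "((\<lambda>s. cos (L T * s)) has_field_derivative - sin (L T * s) * L T) (at s within K)"
      by (auto intro!: derivative_eq_intros)
    from DERIV_add[OF dF[of T s] DERIV_cdivide[OF DERIV_mult[OF du[OF s] this]], of "L T"]
    have "(H T has_field_derivative exp (c * s) * (\<Sum>n\<in>{- int T..int T}. exp (2 * of_real pi * \<i> * of_int n * s))
        + (u' s * cos (L T * s) + - sin (L T * s) * L T * u s) / L T) (at s within K)"
      unfolding H_def .
    also have "(\<Sum>n\<in>{- int T..int T}. exp (2 * of_real pi * \<i> * of_int n * s)) = sin (L T * s) / sin (of_real pi * s)"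
      using dirichlet_kernel[of s T] sinK[OF s] unfolding L_def by (simp add: eq_divide_eq)
    also have "exp (c * s) * (sin (L T * s) / sin (of_real pi * s)) + (u' s * cos (L T * s) + - sin (L T * s) * L T * u s) / L T
        = u' s * cos (L T * s) / L T"
    proof -
      have "(a + - x * L T * y) / L T = a / L T - x * y" for a x y
        using L0[of T] by (simp add: field_simps)
      then show ?thesis by (simp only: u_def) simp
    qed
    finally show ?thesis .
  qed
  have inK: "complex_of_real t \<in> K" "1/2 \<in> K" by (auto simp: K_def)
  have B0: "0 \<le> B" using B[OF inK(1)] norm_ge_zero order_trans by blast
  have bound: "norm (H T (of_real t) - H T (1/2)) \<le> B / (real (2 * T + 1) * pi) * norm (of_real t - (1/2 :: complex))" for T
  proof (rule field_differentiable_bound[OF _ dH])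
    fix s assume s: "s \<in> K"
    have "norm (u' s * cos (L T * s) / L T) = norm (u' s) * norm (cos (L T * s)) / (real (2 * T + 1) * pi)"
      unfolding norm_divide norm_mult nL ..
    also have "\<dots> \<le> B * 1 / (real (2 * T + 1) * pi)"
      by (intro divide_right_mono mult_mono B cosK s B0) auto
    finally show "norm (u' s * cos (L T * s) / L T) \<le> B / (real (2 * T + 1) * pi)" by simp
  qed (use inK in \<open>auto simp: K_def\<close>)
  have null: "(\<lambda>T. C / (real (2 * T + 1) * pi)) \<longlonglongrightarrow> 0" for C :: real
    by real_asymp
  have limH: "(\<lambda>T. H T (of_real t) - H T (1/2)) \<longlonglongrightarrow> 0"
    using null[of "B * norm (of_real t - (1/2 :: complex))"]
    by (rule Lim_null_comparison[rotated]) (use bound in \<open>auto simp: always_eventually\<close>)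
  have limu: "(\<lambda>T. u s * cos (L T * s) / L T) \<longlonglongrightarrow> 0" if s: "s \<in> K" for s
  proof (rule Lim_null_comparison[OF always_eventually null[of "norm (u s)"]], rule allI)
    fix T
    have "norm (u s * cos (L T * s) / L T) = norm (u s) * norm (cos (L T * s)) / (real (2 * T + 1) * pi)"
      unfolding norm_divide norm_mult nL ..
    also have "\<dots> \<le> norm (u s) * 1 / (real (2 * T + 1) * pi)"
      by (intro divide_right_mono mult_mono cosK s) auto
    finally show "norm (u s * cos (L T * s) / L T) \<le> norm (u s) / (real (2 * T + 1) * pi)" by simp
  qed
  have "(\<lambda>T. H T (of_real t) - H T (1/2) - (u (of_real t) * cos (L T * of_real t) / L T - u (1/2) * cos (L T * (1/2)) / L T))
     \<longlonglongrightarrow> 0 - (0 - 0)"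
    by (intro tendsto_diff limH limu inK)
  then have "(\<lambda>T. F T (of_real t) - F T (1/2)) \<longlonglongrightarrow> 0" by (simp add: H_def)
  then show ?thesis by (simp add: F_def fourier_term_def)
qed

lemma fourier_sum_interior:
  assumes c: "exp c \<noteq> 1" and t: "0 < t" "t < 1"
  shows "(\<lambda>T. \<Sum>n\<in>{- int T..int T}. fourier_term c t n) \<longlonglongrightarrow> exp c / (exp c - 1) * exp (- (of_real t * c))"
proof -
  let ?S = "\<lambda>t T. \<Sum>n\<in>{- int T..int T}. fourier_term c t n"
  have "(\<lambda>T. exp (- (c * of_real t)) * ((exp (c * of_real t) * ?S t T - exp (c / 2) * ?S (1/2) T) + exp (c / 2) * ?S (1/2) T))
     \<longlonglongrightarrow> exp (- (c * of_real t)) * (0 + exp (c / 2) * (exp (c / 2) / (exp c - 1)))"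
    by (intro tendsto_intros fourier_sum_interior_diff[OF assms] fourier_sum_at_half[OF c])
  also have "exp (- (c * of_real t)) * (0 + exp (c / 2) * (exp (c / 2) / (exp c - 1))) = exp c / (exp c - 1) * exp (- (of_real t * c))"
    by (simp add: exp_double[symmetric] power2_eq_square[symmetric] mult.commute)
  finally have "(\<lambda>T. exp (- (c * of_real t)) * (exp (c * of_real t) * ?S t T))
     \<longlonglongrightarrow> exp c / (exp c - 1) * exp (- (of_real t * c))" by simp
  then show ?thesis by (simp only: mult.assoc[symmetric] exp_add[symmetric]) simp
qed

lemma periodic_coeff_plus_period:
  assumes "w \<noteq> 0" shows "periodic_coeff w \<omega> (y + w) = periodic_coeff w \<omega> y"
proof -
  have "(y + w) / w = y / w + 1" using assms by (simp add: field_simps)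
  then show ?thesis unfolding periodic_coeff_def by (simp add: frac_1_eq)
qed

lemma real_periodic_coeff_eq:
  "complex_of_real (real_periodic_coeff w D y) = periodic_coeff w (of_real D) y"
  by (simp add: real_periodic_coeff_def periodic_coeff_def Let_def powr_def exp_of_real[symmetric])

lemma periodic_coeff_isCont:
  assumes "y / w \<notin> \<int>" shows "isCont (periodic_coeff w \<omega>) y"
proof -
  have w: "w \<noteq> 0" using assms by auto
  have "isCont (\<lambda>y. frac (y / w)) y"
    using w continuous_frac[OF assms]
    by (intro isCont_o2[where f = "\<lambda>y. y / w" and g = frac]) (auto intro!: continuous_intros)
  then show ?thesis unfolding periodic_coeff_def Let_def by (intro continuous_intros)
qed

text \<open>
From the left \<open>frac (s / w)\<close> tends to \<open>1\<close>, from the right to \<open>0\<close>. The mean of the two limits,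
\<open>w (b + 1) / (2 (b - 1))\<close> with \<open>b = exp (w \<omega>)\<close>, is the value of the series at \<open>0\<close>.
\<close>
lemma periodic_coeff_one_sided:
  assumes w: "0 < w" and y: "y / w \<in> \<int>"
  shows "(periodic_coeff w \<omega> \<longlongrightarrow> of_real w / (exp (of_real w * \<omega>) - 1)) (at_left y)"
    and "(periodic_coeff w \<omega> \<longlongrightarrow> periodic_coeff w \<omega> y) (at_right y)"
    and "periodic_coeff w \<omega> y = exp (of_real w * \<omega>) * of_real w / (exp (of_real w * \<omega>) - 1)"
proof -
  let ?c = "of_real w * \<omega>"
  obtain m where m: "y / w = of_int m" using y by (elim Ints_cases)
  then have ym: "y = of_int m * w" using w by (simp add: field_simps)
  show val: "periodic_coeff w \<omega> y = exp ?c * of_real w / (exp ?c - 1)"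
    by (simp add: periodic_coeff_def Let_def m)
  have "exp ?c * of_real w / (exp ?c - 1) * exp (- (of_real (y / w - of_int m + 1) * ?c))
      = of_real w / (exp ?c - 1) * (exp ?c * exp (- ?c))"
    by (simp add: m)
  then have left: "exp ?c * of_real w / (exp ?c - 1) * exp (- (of_real (y / w - of_int m + 1) * ?c))
      = of_real w / (exp ?c - 1)"
    by (simp only: exp_minus_inverse mult_1_right)
  have "eventually (\<lambda>s. s \<in> {y - w<..<y}) (at_left y)"
    by (rule eventually_at_leftI[of "y - w"]) (use w in auto)
  then have evl: "eventually (\<lambda>s. exp ?c * of_real w / (exp ?c - 1) * exp (- (of_real (s / w - of_int m + 1) * ?c)) = periodic_coeff w \<omega> s) (at_left y)"
  proof eventually_elim
    case (elim s)
    then have "of_int (m - 1) < s / w" "s / w < of_int m" using w by (auto simp: ym field_simps)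
    then have "\<lfloor>s / w\<rfloor> = m - 1" by (intro floor_unique) auto
    then have "frac (s / w) = s / w - of_int m + 1" by (simp add: frac_def)
    then show ?case by (simp add: periodic_coeff_def Let_def)
  qed
  have "((\<lambda>s. exp ?c * of_real w / (exp ?c - 1) * exp (- (of_real (s / w - of_int m + 1) * ?c))) \<longlongrightarrow>
      exp ?c * of_real w / (exp ?c - 1) * exp (- (of_real (y / w - of_int m + 1) * ?c))) (at_left y)"
    using w by (intro tendsto_intros) auto
  from Lim_transform_eventually[OF this evl]
  show "(periodic_coeff w \<omega> \<longlongrightarrow> of_real w / (exp ?c - 1)) (at_left y)"
    unfolding left .
  have "eventually (\<lambda>s. s \<in> {y<..<y + w}) (at_right y)"
    by (rule eventually_at_rightI[of _ "y + w"]) (use w in auto)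
  then have evr: "eventually (\<lambda>s. exp ?c * of_real w / (exp ?c - 1) * exp (- (of_real (s / w - of_int m) * ?c)) = periodic_coeff w \<omega> s) (at_right y)"
  proof eventually_elim
    case (elim s)
    then have "of_int m < s / w" "s / w < of_int m + 1" using w by (auto simp: ym field_simps)
    then have "\<lfloor>s / w\<rfloor> = m" by (intro floor_unique) auto
    then have "frac (s / w) = s / w - of_int m" by (simp add: frac_def)
    then show ?case by (simp add: periodic_coeff_def Let_def)
  qed
  have "((\<lambda>s. exp ?c * of_real w / (exp ?c - 1) * exp (- (of_real (s / w - of_int m) * ?c))) \<longlongrightarrow>
      exp ?c * of_real w / (exp ?c - 1) * exp (- (of_real (y / w - of_int m) * ?c))) (at_right y)"
    using w by (intro tendsto_intros) auto
  from Lim_transform_eventually[OF this evr]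
  show "(periodic_coeff w \<omega> \<longlongrightarrow> periodic_coeff w \<omega> y) (at_right y)"
    by (simp add: m val)
qed

lemma fourier_series_periodic_coeff:
  assumes w: "0 < w" and b: "exp (of_real w * \<omega>) \<noteq> 1"
  shows "y / w \<notin> \<int> \<Longrightarrow> bilateral_sums
      (\<lambda>n. exp (2 * of_real pi * \<i> * of_int n * of_real y / of_real w) / shifted_dim w \<omega> n) (periodic_coeff w \<omega> y)"
    and "y / w \<in> \<int> \<Longrightarrow> bilateral_sums
      (\<lambda>n. exp (2 * of_real pi * \<i> * of_int n * of_real y / of_real w) / shifted_dim w \<omega> n)
      ((of_real w / (exp (of_real w * \<omega>) - 1) + periodic_coeff w \<omega> y) / 2)"
proof -
  let ?c = "of_real w * \<omega>" let ?t = "frac (y / w)"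
  have trm: "exp (2 * of_real pi * \<i> * of_int n * of_real y / of_real w) / shifted_dim w \<omega> n
      = of_real w * fourier_term ?c ?t n" for n
  proof -
    have "y / w = ?t + of_int \<lfloor>y / w\<rfloor>" by (simp add: frac_def)
    then have "2 * of_real pi * \<i> * of_int n * of_real y / of_real w
       = 2 * of_real pi * \<i> * of_int n * of_real (?t + of_int \<lfloor>y / w\<rfloor>)"
      by (metis of_real_divide times_divide_eq_right)
    also have "\<dots> = 2 * of_real pi * \<i> * of_int n * of_real ?t + of_int (2 * (n * \<lfloor>y / w\<rfloor>)) * of_real pi * \<i>"
      by (simp add: algebra_simps)
    also have "exp \<dots> = exp (2 * of_real pi * \<i> * of_int n * of_real ?t) * exp (of_int (2 * (n * \<lfloor>y / w\<rfloor>)) * of_real pi * \<i>)"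
      by (rule exp_add)
    also have "exp (of_int (2 * (n * \<lfloor>y / w\<rfloor>)) * of_real pi * \<i>) = 1"
      unfolding exp_eq_1 by (auto intro!: exI[of _ "n * \<lfloor>y / w\<rfloor>"])
    finally have e: "exp (2 * of_real pi * \<i> * of_int n * of_real y / of_real w) = exp (2 * of_real pi * \<i> * of_int n * of_real ?t)"
      by simp
    have "of_real w * shifted_dim w \<omega> n = ?c + 2 * of_real pi * \<i> * of_int n"
      using w by (simp add: shifted_dim_def field_simps)
    then show ?thesis unfolding e fourier_term_def using w by (metis mult_divide_mult_cancel_left of_real_eq_0_iff less_irrefl times_divide_eq_right)
  qed
  have sums: "(\<lambda>T. \<Sum>n\<in>{- int T..int T}. fourier_term ?c ?t n) \<longlonglongrightarrow> S \<Longrightarrow> bilateral_sums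
      (\<lambda>n. exp (2 * of_real pi * \<i> * of_int n * of_real y / of_real w) / shifted_dim w \<omega> n) (of_real w * S)" for S
    unfolding bilateral_sums_def trm sum_distrib_left[symmetric] by (rule tendsto_mult_left)
  {
    assume y: "y / w \<notin> \<int>"
    then have "0 < ?t" "?t < 1" by (auto simp: frac_gt_0_iff frac_lt_1)
    from sums[OF fourier_sum_interior[OF b this]]
    show "bilateral_sums
      (\<lambda>n. exp (2 * of_real pi * \<i> * of_int n * of_real y / of_real w) / shifted_dim w \<omega> n) (periodic_coeff w \<omega> y)"
      by (simp add: periodic_coeff_def Let_def mult_ac)
  next
    assume y: "y / w \<in> \<int>"
    then have "?t = 0" by (simp add: frac_eq_0_iff)
    moreover have "of_real w * ((exp ?c + 1) / (2 * (exp ?c - 1))) = (of_real w / (exp ?c - 1) + periodic_coeff w \<omega> y) / 2"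
      unfolding periodic_coeff_one_sided(3)[OF w y] using b by (simp add: add_divide_distrib[symmetric] algebra_simps)
    ultimately show "bilateral_sums
      (\<lambda>n. exp (2 * of_real pi * \<i> * of_int n * of_real y / of_real w) / shifted_dim w \<omega> n)
      ((of_real w / (exp (of_real w * \<omega>) - 1) + periodic_coeff w \<omega> y) / 2)"
      using sums[of "(exp ?c + 1) / (2 * (exp ?c - 1))"] fourier_sum_at_0[OF b] by (simp only:)
  }
qed

lemma given_by_series_periodic_coeff:
  assumes w: "0 < w" and b: "exp (of_real w * \<omega>) \<noteq> 1"
  shows "given_by_series w \<omega> (periodic_coeff w \<omega>)"
  unfolding given_by_series_def
  using fourier_series_periodic_coeff[OF w b] periodic_coeff_one_sided(1,2)[OF w] by blast

section \<open>The explicit formula and the error term\<close>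

lemma norm_periodic_coeff_bounded:
  shows "\<exists>B. \<forall>y. norm (periodic_coeff w \<omega> y) \<le> B"
proof (intro exI allI)
  fix y
  let ?b = "exp (of_real w * \<omega>)"
  have "norm (exp (- (of_real (frac (y / w)) * (of_real w * \<omega>)))) \<le> exp (norm (- (of_real (frac (y / w)) * (of_real w * \<omega>))))"
    by (rule norm_exp)
  also have "norm (- (of_real (frac (y / w)) * (of_real w * \<omega>))) = frac (y / w) * norm (of_real w * \<omega>)"
    by (simp add: norm_mult)
  also have "\<dots> \<le> 1 * norm (of_real w * \<omega>)"
    by (intro mult_right_mono) (auto simp: less_imp_le frac_lt_1)
  finally have "norm (exp (- (of_real (frac (y / w)) * (of_real w * \<omega>)))) \<le> exp (norm (of_real w * \<omega>))" by simp
  then show "norm (periodic_coeff w \<omega> y) \<le> norm (?b * of_real w / (?b - 1)) * exp (norm (of_real w * \<omega>))"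
    unfolding periodic_coeff_def Let_def norm_mult[of "?b * of_real w / (?b - 1)"] by (intro mult_left_mono) auto
qed

locale lattice_flow =
  fixes N :: nat and W :: "nat \<Rightarrow> real" and w D :: real and k :: "nat \<Rightarrow> nat"
  assumes N: "2 \<le> N"
    and w_pos: "0 < w"
    and k_pos: "\<forall>j\<in>{1..N}. 0 < k j"
    and W_eq: "\<forall>j\<in>{1..N}. W j = real (k j) * w"
    and k_coprime: "Gcd (k ` {1..N}) = 1"
    and D_eq: "(\<Sum>j=1..N. exp (- (W j * D))) = 1"
begin

abbreviation f :: "complex poly" where "f \<equiv> weight_poly N k"

definition r :: real where "r = exp (- (w * D))"

lemma r_pos: "0 < r" by (simp add: r_def)

lemma sum_r: "(\<Sum>j=1..N. r ^ k j) = 1"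
proof -
  have "r ^ k j = exp (- (W j * D))" if "j \<in> {1..N}" for j
    using W_eq that by (simp add: r_def exp_of_nat_mult[symmetric] mult_ac)
  then show ?thesis using D_eq by simp
qed

lemma root_r: "poly f (of_real r) = 0"
proof -
  have "poly f (of_real r) = 1 - of_real (\<Sum>j=1..N. r ^ k j)" by (simp add: poly_weight_poly)
  then show ?thesis unfolding sum_r by simp
qed

lemma exp_D: "exp (- (of_real w * complex_of_real D)) = of_real r"
  by (simp add: r_def exp_of_real[symmetric])

lemma mem_complex_dimensions:
  "\<omega> \<in> complex_dimensions N W \<longleftrightarrow> poly f (exp (- (of_real w * \<omega>))) = 0"
  using complex_dimensions_eq[OF k_pos W_eq w_pos] by simp

lemma exp_neq_1:
  assumes "\<omega> \<in> complex_dimensions N W" shows "exp (of_real w * \<omega>) \<noteq> 1"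
  using root_weight_poly(2)[OF N k_pos] assms by (force simp: mem_complex_dimensions exp_minus)

lemma Re_ge_D:
  assumes "\<omega> \<in> complex_dimensions N W" "D \<le> Re \<omega>"
  shows "exp (- (of_real w * \<omega>)) = of_real r"
proof (rule dominant_root[OF k_pos k_coprime r_pos sum_r])
  show "poly f (exp (- (of_real w * \<omega>))) = 0" using assms by (simp add: mem_complex_dimensions)
  show "norm (exp (- (of_real w * \<omega>))) \<le> r"
    using assms w_pos by (simp add: r_def norm_exp_eq_Re)
qed

text \<open>
The real part of a complex dimension is determined by the root \<open>z\<close> as \<open>- ln \<bar>z\<bar> / w\<close>, so only
finitely many abscissas occur.
\<close>
lemma next_abscissa_exists:
  assumes "\<exists>\<omega>\<in>complex_dimensions N W. Re \<omega> < D"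
  shows "\<exists>\<alpha>. next_abscissa N W D (D - \<alpha>)"
proof -
  define A where "A = {Re \<omega> | \<omega>. \<omega> \<in> complex_dimensions N W \<and> Re \<omega> < D}"
  have "Re \<omega> = - ln (norm (exp (- (of_real w * \<omega>)))) / w" for \<omega>
    using w_pos by (simp add: norm_exp_eq_Re)
  then have "A \<subseteq> (\<lambda>z. - ln (norm z) / w) ` {z. poly f z = 0}"
    unfolding A_def mem_complex_dimensions by blast
  then have fin: "finite A"
    using poly_roots_finite[OF weight_poly_nonzero[OF k_pos]] finite_subset by blast
  have "A \<noteq> {}" using assms unfolding A_def by blast
  then have "Max A \<in> A" "\<forall>a\<in>A. a \<le> Max A" using fin by auto
  then have "next_abscissa N W D (D - (D - Max A))"
    unfolding next_abscissa_def A_def by auto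
  then show ?thesis by blast
qed

text \<open>
The roots are enumerated with the real root \<open>r\<close> first, and logarithms are chosen such that \<open>r\<close> is
represented by \<open>D\<close> itself.
\<close>
lemma dimension_reps_exist: "\<exists>q \<omega>. dimension_reps N k w D q \<omega>"
proof -
  define R where "R = {z::complex. poly f z = 0}"
  have finR: "finite R" unfolding R_def using poly_roots_finite[OF weight_poly_nonzero[OF k_pos]] .
  have R0: "z \<noteq> 0" if "z \<in> R" for z using root_weight_poly(1)[OF N k_pos] that by (simp add: R_def)
  have rR: "of_real r \<in> R" by (simp add: R_def root_r)
  define q where "q = card R"
  obtain h where h: "bij_betw h {1..q} R" using ex_bij_betw_nat_finite_1[OF finR] unfolding q_def by blast
  obtain i where i: "i \<in> {1..q}" "h i = of_real r" using h rR unfolding bij_betw_def by (metis imageE)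
  define g where "g = h \<circ> Transposition.transpose 1 i"
  have g: "bij_betw g {1..q} R" unfolding g_def
    by (rule bij_betw_trans[OF permutes_imp_bij h]) (use i in \<open>auto intro: permutes_swap_id\<close>)
  have g1: "g 1 = of_real r" by (simp add: g_def i)
  define \<omega> where "\<omega> u = (if u = 1 then of_real D else - Ln (g u) / of_real w)" for u
  have "exp (- (of_real w * \<omega> u)) = g u" if "u \<in> {1..q}" for u
    using w_pos R0[of "g u"] g that g1 by (auto simp: \<omega>_def exp_D bij_betw_def)
  then have "bij_betw (\<lambda>u. exp (- (of_real w * \<omega> u))) {1..q} R \<longleftrightarrow> bij_betw g {1..q} R"
    by (rule bij_betw_cong)
  with g have "dimension_reps N k w D q \<omega>"
    using i unfolding dimension_reps_def by (auto simp: \<omega>_def R_def poly_weight_poly eq_commute[of 1])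
  then show ?thesis by blast
qed

context
  fixes q :: nat and \<omega> :: "nat \<Rightarrow> complex"
  assumes reps: "dimension_reps N k w D q \<omega>"
begin

lemma bij_reps: "bij_betw (\<lambda>u. exp (- (of_real w * \<omega> u))) {1..q} {z. poly f z = 0}"
  using reps by (simp add: dimension_reps_def poly_weight_poly eq_commute[of 1])

lemma \<omega>_1: "\<omega> 1 = of_real D" and q_pos: "1 \<le> q"
  using reps by (auto simp: dimension_reps_def)

lemma \<omega>_dimension: "u \<in> {1..q} \<Longrightarrow> \<omega> u \<in> complex_dimensions N W"
  using bij_reps by (auto simp: mem_complex_dimensions bij_betw_def)

lemma complex_dimensions_reps:
  "complex_dimensions N W = {shifted_dim w (\<omega> u) n | u n. u \<in> {1..q}}"
proof -
  have per: "exp (- (of_real w * shifted_dim w v n)) = exp (- (of_real w * v))" for v n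
  proof -
    have "- (of_real w * shifted_dim w v n) = - (of_real w * v) + of_real (of_int (2 * - n) * pi) * \<i>"
      using w_pos by (simp add: shifted_dim_def field_simps)
    then show ?thesis unfolding exp_eq by blast
  qed
  have "\<exists>u n. s = shifted_dim w (\<omega> u) n \<and> u \<in> {1..q}" if "s \<in> complex_dimensions N W" for s
  proof -
    from that bij_reps obtain u where u: "u \<in> {1..q}" "exp (- (of_real w * s)) = exp (- (of_real w * \<omega> u))"
      unfolding mem_complex_dimensions bij_betw_def by blast
    then obtain n :: int where "- (of_real w * s) = - (of_real w * \<omega> u) + of_real (of_int (2 * n) * pi) * \<i>"
      unfolding exp_eq by blast
    then have "of_real w * s = of_real w * shifted_dim w (\<omega> u) (- n)"
      using w_pos by (simp add: shifted_dim_def field_simps)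
    then have "s = shifted_dim w (\<omega> u) (- n)" using w_pos by simp
    with u show ?thesis by blast
  qed
  then show ?thesis using \<omega>_dimension per by (auto simp: mem_complex_dimensions)
qed

lemma Re_other_reps:
  assumes "u \<in> {1..q}" "u \<noteq> 1" shows "Re (\<omega> u) < D"
proof (rule ccontr)
  assume "\<not> Re (\<omega> u) < D"
  then have "exp (- (of_real w * \<omega> u)) = exp (- (of_real w * \<omega> 1))"
    using Re_ge_D[OF \<omega>_dimension[OF assms(1)]] unfolding \<omega>_1 exp_D by simp
  then have "u = 1"
    by (rule inj_onD[OF bij_betw_imp_inj_on[OF bij_reps]]) (use assms q_pos in auto)
  with assms show False by simp
qed

lemma zorder_at_D: "zorder (dyn_zeta N W) (\<omega> 1) = - 1"
  unfolding zorder_dyn_zeta[OF k_pos W_eq w_pos] \<omega>_1 exp_D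
  using order_dominant_root[OF _ k_pos r_pos sum_r] N by simp

lemma orbit_psi_explicit:
  assumes x: "1 \<le> x"
  shows "complex_of_real (orbit_psi N W x) =
    (\<Sum>u=1..q. - of_int (zorder (dyn_zeta N W) (\<omega> u)) * periodic_coeff w (\<omega> u) (ln x) * of_real x powr \<omega> u)
    - 1 / (of_nat N - 1) * (\<Sum>j=1..N. of_real (W j))"
proof -
  define z where "z u = exp (- (of_real w * \<omega> u))" for u
  have bij: "bij_betw z {1..q} {z. poly f z = 0}" unfolding z_def by (rule bij_reps)
  have ord: "of_nat (order (z u) f) = (- of_int (zorder (dyn_zeta N W) (\<omega> u)) :: complex)" for u
    by (simp add: zorder_dyn_zeta[OF k_pos W_eq w_pos] z_def)
  have z1: "z u \<noteq> 1" if "u \<in> {1..q}" for u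
    using bij_betw_apply[OF bij that] root_weight_poly(2)[OF N k_pos] by blast
  have const: "(\<Sum>u=1..q. of_nat (order (z u) f) * (of_real w / (1 - z u)))
      = 1 / (of_nat N - 1) * (\<Sum>j=1..N. of_real (W j))"
  proof -
    have "(\<Sum>u=1..q. of_nat (order (z u) f) * (of_real w / (1 - z u)))
        = of_real w * (\<Sum>u=1..q. of_nat (order (z u) f) / (1 - z u))"
      by (simp add: sum_distrib_left mult_ac)
    also have "(\<Sum>u=1..q. of_nat (order (z u) f) / (1 - z u)) = (\<Sum>z | poly f z = 0. of_nat (order z f) / (1 - z))"
      by (rule sum.reindex_bij_betw[OF bij])
    also have "\<dots> = (\<Sum>j=1..N. of_nat (k j)) / (of_nat N - 1)" by (rule sum_roots_at_one[OF N k_pos])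
    also have "of_real w * \<dots> = 1 / (of_nat N - 1) * (\<Sum>j=1..N. of_nat (k j) * of_real w)"
      unfolding sum_distrib_right[symmetric] by simp
    also have "(\<Sum>j=1..N. of_nat (k j) * complex_of_real w) = (\<Sum>j=1..N. of_real (W j))"
      using W_eq by (intro sum.cong) auto
    finally show ?thesis .
  qed
  have "complex_of_real (orbit_psi N W x) = (\<Sum>z | poly f z = 0.
      of_nat (order z f) * (of_real w * (\<Sum>n=1..nat \<lfloor>ln x / w\<rfloor>. inverse z ^ n)))"
    by (rule orbit_psi_eq_power_sums[OF k_pos W_eq w_pos x])
  also have "\<dots> = (\<Sum>u=1..q. of_nat (order (z u) f) * (of_real w * (\<Sum>n=1..nat \<lfloor>ln x / w\<rfloor>. inverse (z u) ^ n)))"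
    by (rule sum.reindex_bij_betw[OF bij, symmetric])
  also have "\<dots> = (\<Sum>u=1..q. of_nat (order (z u) f) *
      (periodic_coeff w (\<omega> u) (ln x) * of_real x powr \<omega> u - of_real w / (1 - z u)))"
    using geometric_sum_eq_periodic_coeff[OF w_pos x z_def[symmetric] z1] by simp
  also have "\<dots> = (\<Sum>u=1..q. of_nat (order (z u) f) * periodic_coeff w (\<omega> u) (ln x) * of_real x powr \<omega> u)
     - (\<Sum>u=1..q. of_nat (order (z u) f) * (of_real w / (1 - z u)))"
    by (simp add: right_diff_distrib sum_subtractf mult.assoc)
  finally show ?thesis unfolding const unfolding ord .
qed

text \<open>
The term of \<open>u = 1\<close> is the leading term; by \<open>Re_other_reps\<close>, the exponents of the others have smaller
real part.
\<close>
lemma orbit_psi_remainder: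
  assumes x: "1 \<le> x"
  shows "complex_of_real (orbit_psi N W x -
      (real_periodic_coeff w D (ln x) * x powr D - 1 / (real N - 1) * (\<Sum>j=1..N. W j)))
    = (\<Sum>u=2..q. - of_int (zorder (dyn_zeta N W) (\<omega> u)) * periodic_coeff w (\<omega> u) (ln x) * of_real x powr \<omega> u)"
proof -
  define t where "t u = - of_int (zorder (dyn_zeta N W) (\<omega> u)) * periodic_coeff w (\<omega> u) (ln x) * of_real x powr \<omega> u" for u
  have "(\<Sum>u=1..q. t u) = t 1 + (\<Sum>u=2..q. t u)"
    using q_pos by (simp add: sum.atLeast_Suc_atMost numeral_2_eq_2)
  moreover have "t 1 = of_real (real_periodic_coeff w D (ln x) * x powr D)"
    unfolding t_def zorder_at_D unfolding \<omega>_1 using x by (simp add: real_periodic_coeff_eq powr_of_real)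
  ultimately show ?thesis using orbit_psi_explicit[OF x] unfolding t_def[symmetric] by simp
qed

lemma orbit_psi_asymptotics:
  assumes next_ab: "next_abscissa N W D \<beta>"
  shows "(\<lambda>x. orbit_psi N W x
      - (real_periodic_coeff w D (ln x) * x powr D - 1 / (real N - 1) * (\<Sum>j=1..N. W j)))
    \<in> O[at_top](\<lambda>x. x powr \<beta>)"
proof -
  define m where "m u = norm (of_int (zorder (dyn_zeta N W) (\<omega> u)) :: complex)" for u
  have "\<forall>u. \<exists>B. \<forall>y. norm (periodic_coeff w (\<omega> u) y) \<le> B" using norm_periodic_coeff_bounded by blast
  then obtain B where B: "\<And>u y. norm (periodic_coeff w (\<omega> u) y) \<le> B u" by metis
  have "norm (orbit_psi N W x - (real_periodic_coeff w D (ln x) * x powr D - 1 / (real N - 1) * (\<Sum>j=1..N. W j)))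
      \<le> (\<Sum>u=2..q. m u * B u) * norm (x powr \<beta>)" if x: "1 \<le> x" for x
  proof -
    have "norm (orbit_psi N W x - (real_periodic_coeff w D (ln x) * x powr D - 1 / (real N - 1) * (\<Sum>j=1..N. W j)))
       = norm (\<Sum>u=2..q. - of_int (zorder (dyn_zeta N W) (\<omega> u)) * periodic_coeff w (\<omega> u) (ln x) * of_real x powr \<omega> u)"
      unfolding orbit_psi_remainder[OF x, symmetric] norm_of_real real_norm_def ..
    also have "\<dots> \<le> (\<Sum>u=2..q. m u * B u * x powr \<beta>)"
    proof (rule sum_norm_le)
      fix u assume u: "u \<in> {2..q}"
      then have "\<omega> u \<in> complex_dimensions N W" "Re (\<omega> u) < D" using \<omega>_dimension Re_other_reps by auto
      then have "Re (\<omega> u) \<le> \<beta>" using next_ab unfolding next_abscissa_def by blast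
      then have "x powr Re (\<omega> u) \<le> x powr \<beta>" using x by (intro powr_mono) auto
      moreover have "norm (of_real x powr \<omega> u) = x powr Re (\<omega> u)" using x by (subst norm_powr_real_powr) auto
      moreover have "0 \<le> B u" using B[of u 0] norm_ge_zero order_trans by blast
      ultimately show "norm (- of_int (zorder (dyn_zeta N W) (\<omega> u)) * periodic_coeff w (\<omega> u) (ln x) * of_real x powr \<omega> u)
          \<le> m u * B u * x powr \<beta>"
        unfolding norm_mult norm_minus_cancel m_def by (intro mult_mono B mult_left_mono mult_nonneg_nonneg) auto
    qed
    finally show ?thesis by (simp add: sum_distrib_right)
  qed
  then show ?thesis by (intro bigoI) (auto simp: eventually_at_top_linorder)
qed

lemma orbit_psi_single_line:
  assumes none: "\<not> (\<exists>\<omega>\<in>complex_dimensions N W. Re \<omega> < D)" and x: "1 \<le> x"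
  shows "orbit_psi N W x = real_periodic_coeff w D (ln x) * x powr D - 1 / (real N - 1) * (\<Sum>j=1..N. W j)"
proof -
  have "u \<notin> {2..q}" for u
  proof
    assume "u \<in> {2..q}"
    then have "u \<in> {1..q}" "u \<noteq> 1" by auto
    then show False using none \<omega>_dimension Re_other_reps by blast
  qed
  then have none: "{2..q} = {}" by blast
  show ?thesis
    using orbit_psi_remainder[OF x] unfolding none sum.empty of_real_eq_0_iff by (simp only: right_minus_eq)
qed

text \<open>
The function \<open>\<psi>\<close> and the bilateral series can jump only where \<open>ln x / w\<close> is an integer. The left limit of \<open>\<psi>\<close> comes
from the explicit formula, whose only discontinuous factors are the periodic coefficients. A series
converges to the mean of the one-sided limits of its coefficient, and the explicit formula is linear
in the coefficients, so the mean of \<open>\<psi>\<close> and its left limit is represented. Away from the jumps the two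
values coincide.
\<close>
lemma orbit_psi_series:
  assumes x: "1 < x"
  shows "\<exists>S l. (\<forall>u\<in>{1..q}. bilateral_sums
        (\<lambda>n. of_real x powr shifted_dim w (\<omega> u) n / shifted_dim w (\<omega> u) n) (S u))
     \<and> (orbit_psi N W \<longlongrightarrow> l) (at_left x)
     \<and> (ln x / w \<notin> \<int> \<longrightarrow> l = orbit_psi N W x)
     \<and> complex_of_real ((l + orbit_psi N W x) / 2) =
         (\<Sum>u=1..q. - of_int (zorder (dyn_zeta N W) (\<omega> u)) * S u)
         - 1 / (of_nat N - 1) * (\<Sum>j=1..N. of_real (W j))"
proof -
  let ?g = "\<lambda>u. periodic_coeff w (\<omega> u)" and ?m = "\<lambda>u. - of_int (zorder (dyn_zeta N W) (\<omega> u)) :: complex"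
    and ?C = "1 / (of_nat N - 1) * (\<Sum>j=1..N. of_real (W j)) :: complex"
  define L where "L u = (if ln x / w \<in> \<int> then of_real w / (exp (of_real w * \<omega> u) - 1) else ?g u (ln x))" for u
  define S where "S u = of_real x powr \<omega> u * ((L u + ?g u (ln x)) / 2)" for u
  define l where "l = (\<Sum>u=1..q. ?m u * L u * of_real x powr \<omega> u) - ?C"
  have xpow: "of_real x powr s = exp (s * of_real (ln x))" for s :: complex
    using x by (simp add: powr_def Ln_of_real)
  have "bilateral_sums (\<lambda>n. of_real x powr shifted_dim w (\<omega> u) n / shifted_dim w (\<omega> u) n) (S u)"
    if u: "u \<in> {1..q}" for u
  proof -
    have "bilateral_sums (\<lambda>n. exp (2 * of_real pi * \<i> * of_int n * of_real (ln x) / of_real w) / shifted_dim w (\<omega> u) n)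
        ((L u + ?g u (ln x)) / 2)"
      using fourier_series_periodic_coeff[OF w_pos exp_neq_1[OF \<omega>_dimension[OF u]], of "ln x"]
      by (cases "ln x / w \<in> \<int>") (auto simp: L_def)
    then have "bilateral_sums (\<lambda>n. of_real x powr \<omega> u *
        (exp (2 * of_real pi * \<i> * of_int n * of_real (ln x) / of_real w) / shifted_dim w (\<omega> u) n)) (S u)"
      unfolding bilateral_sums_def S_def sum_distrib_left[symmetric] by (rule tendsto_mult_left)
    moreover have "of_real x powr \<omega> u * (exp (2 * of_real pi * \<i> * of_int n * of_real (ln x) / of_real w) / shifted_dim w (\<omega> u) n)
        = of_real x powr shifted_dim w (\<omega> u) n / shifted_dim w (\<omega> u) n" for n
    proof -
      have "shifted_dim w (\<omega> u) n * of_real (ln x) = \<omega> u * of_real (ln x) + 2 * of_real pi * \<i> * of_int n * of_real (ln x) / of_real w"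
        by (simp add: shifted_dim_def distrib_right)
      then show ?thesis unfolding xpow by (simp only: exp_add times_divide_eq_right)
    qed
    ultimately show ?thesis by (simp only:)
  qed
  moreover have lim: "((\<lambda>s. complex_of_real (orbit_psi N W s)) \<longlongrightarrow> l) (at_left x)"
  proof -
    have inc: "eventually (\<lambda>s. s \<in> {1<..<x}) (at_left x)"
      by (rule eventually_at_leftI[of 1]) (use x in auto)
    have "((\<lambda>s. ln s) \<longlongrightarrow> ln x) (at_left x)" using x by (intro tendsto_intros) auto
    moreover have "eventually (\<lambda>s. ln s \<in> {..<ln x} \<and> ln s \<noteq> ln x) (at_left x)"
      using inc by eventually_elim auto
    ultimately have ln: "filterlim ln (at_left (ln x)) (at_left x)"
      unfolding filterlim_at by auto
    have gl: "(?g u \<longlongrightarrow> L u) (at_left (ln x))" for u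
    proof (cases "ln x / w \<in> \<int>")
      case True
      then show ?thesis using periodic_coeff_one_sided(1)[OF w_pos True] by (simp add: L_def)
    next
      case False
      then show ?thesis
        using filterlim_mono[OF periodic_coeff_isCont[OF False, unfolded isCont_def] order_refl at_le[of "{..<ln x}" UNIV "ln x"]]
        by (simp add: L_def)
    qed
    have "((\<lambda>s. (\<Sum>u=1..q. ?m u * ?g u (ln s) * of_real s powr \<omega> u) - ?C) \<longlongrightarrow> l) (at_left x)"
      unfolding l_def
      by (intro tendsto_intros filterlim_compose[OF gl ln] tendsto_powr_complex)
         (use x in \<open>auto simp: complex_nonpos_Reals_iff\<close>)
    moreover have "eventually (\<lambda>s. (\<Sum>u=1..q. ?m u * ?g u (ln s) * of_real s powr \<omega> u) - ?C
        = complex_of_real (orbit_psi N W s)) (at_left x)"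
      using inc by eventually_elim (simp only: orbit_psi_explicit less_imp_le greaterThanLessThan_iff)
    ultimately show ?thesis by (rule Lim_transform_eventually)
  qed
  have "Im l = 0"
    using tendsto_Im[OF lim] by (simp add: tendsto_const_iff)
  then have l: "complex_of_real (Re l) = l" by (simp add: complex_eq_iff)
  have "(orbit_psi N W \<longlongrightarrow> Re l) (at_left x)" using tendsto_Re[OF lim] by simp
  moreover have "ln x / w \<notin> \<int> \<longrightarrow> Re l = orbit_psi N W x"
  proof
    assume "ln x / w \<notin> \<int>"
    then have "l = complex_of_real (orbit_psi N W x)"
      using orbit_psi_explicit[of x] x by (simp add: l_def L_def)
    then show "Re l = orbit_psi N W x" by simp
  qed
  moreover have "complex_of_real ((Re l + orbit_psi N W x) / 2) = (\<Sum>u=1..q. ?m u * S u) - ?C"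
  proof -
    have "complex_of_real ((Re l + orbit_psi N W x) / 2) = (l + complex_of_real (orbit_psi N W x)) / 2"
      using l by simp
    also have "complex_of_real (orbit_psi N W x) = (\<Sum>u=1..q. ?m u * ?g u (ln x) * of_real x powr \<omega> u) - ?C"
      using orbit_psi_explicit[of x] x by simp
    also have "(l + \<dots>) / 2 = ((\<Sum>u=1..q. ?m u * L u * of_real x powr \<omega> u)
        + (\<Sum>u=1..q. ?m u * ?g u (ln x) * of_real x powr \<omega> u)) / 2 - ?C"
    proof -
      have "((a - c) + (b - c)) / 2 = (a + b) / 2 - c" for a b c :: complex by (simp add: field_simps)
      then show ?thesis unfolding l_def .
    qed
    also have "((\<Sum>u=1..q. ?m u * L u * of_real x powr \<omega> u)
        + (\<Sum>u=1..q. ?m u * ?g u (ln x) * of_real x powr \<omega> u)) / 2 = (\<Sum>u=1..q. ?m u * S u)"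
    proof -
      have "(m * a * p + m * b * p) / 2 = m * (p * ((a + b) / 2))" for m a b p :: complex
        by (simp add: field_simps)
      then show ?thesis unfolding sum.distrib[symmetric] sum_divide_distrib S_def by (simp only:)
    qed
    finally show ?thesis .
  qed
  ultimately show ?thesis by blast
qed

end

end

theorem mainTheorem4:
  fixes N :: nat and W :: "nat \<Rightarrow> real" and w D :: real and k :: "nat \<Rightarrow> nat"
  assumes N: "2 \<le> N"
    and W_pos: "0 < W 1"
    and W_mono: "mono_on {1..N} W"
    and lattice: "lattice_weights N W"
    and w_pos: "0 < w"
    and k_pos: "\<forall>j\<in>{1..N}. 0 < k j"
    and W_eq: "\<forall>j\<in>{1..N}. W j = real (k j) * w"
    and k_coprime: "Gcd (k ` {1..N}) = 1"
    and D_pos: "0 < D"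
    and D_eq: "(\<Sum>j=1..N. exp (- (W j * D))) = 1"
  shows
    "(\<forall>\<alpha>. next_abscissa N W D (D - \<alpha>) \<longrightarrow>
        (\<lambda>x. orbit_psi N W x
               - (real_periodic_coeff w D (ln x) * x powr D - 1 / (real N - 1) * (\<Sum>j=1..N. W j)))
          \<in> O[at_top](\<lambda>x. x powr (D - \<alpha>)))
     \<and> ((\<exists>\<omega>\<in>complex_dimensions N W. Re \<omega> < D) \<longrightarrow> (\<exists>\<alpha>. next_abscissa N W D (D - \<alpha>)))
     \<and> (\<not> (\<exists>\<omega>\<in>complex_dimensions N W. Re \<omega> < D) \<longrightarrow>
          (\<forall>x\<ge>1. orbit_psi N W x =
             real_periodic_coeff w D (ln x) * x powr D - 1 / (real N - 1) * (\<Sum>j=1..N. W j)))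
     \<and> (\<forall>y. real_periodic_coeff w D (y + w) = real_periodic_coeff w D y)
     \<and> given_by_series w (of_real D) (\<lambda>y. of_real (real_periodic_coeff w D y))
     \<and> (\<exists>q \<omega>. dimension_reps N k w D q \<omega>)
     \<and> (\<forall>q \<omega>. dimension_reps N k w D q \<omega> \<longrightarrow>
          complex_dimensions N W = {shifted_dim w (\<omega> u) n | u n. u \<in> {1..q}}
          \<and> zorder (dyn_zeta N W) (\<omega> 1) = - 1
          \<and> (\<forall>u\<in>{1..q}.
                (\<forall>y. periodic_coeff w (\<omega> u) (y + w) = periodic_coeff w (\<omega> u) y)
                \<and> given_by_series w (\<omega> u) (periodic_coeff w (\<omega> u)))
          \<and> (\<forall>x\<ge>1. complex_of_real (orbit_psi N W x) =
                (\<Sum>u=1..q. - of_int (zorder (dyn_zeta N W) (\<omega> u))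
                     * periodic_coeff w (\<omega> u) (ln x) * of_real x powr \<omega> u)
                - 1 / (of_nat N - 1) * (\<Sum>j=1..N. of_real (W j)))
          \<and> (\<forall>x>1. \<exists>S l.
                (\<forall>u\<in>{1..q}. bilateral_sums
                   (\<lambda>n. of_real x powr shifted_dim w (\<omega> u) n / shifted_dim w (\<omega> u) n) (S u))
                \<and> (orbit_psi N W \<longlongrightarrow> l) (at_left x)
                \<and> (ln x / w \<notin> \<int> \<longrightarrow> l = orbit_psi N W x)
                \<and> complex_of_real ((l + orbit_psi N W x) / 2) =
                     (\<Sum>u=1..q. - of_int (zorder (dyn_zeta N W) (\<omega> u)) * S u)
                     - 1 / (of_nat N - 1) * (\<Sum>j=1..N. of_real (W j))))"
proof -
  interpret lattice_flow N W w D k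
    by unfold_locales (fact N w_pos k_pos W_eq k_coprime D_eq)+
  obtain q0 \<omega>0 where reps0: "dimension_reps N k w D q0 \<omega>0" using dimension_reps_exist by blast
  have D_dim: "of_real D \<in> complex_dimensions N W"
    by (simp add: mem_complex_dimensions exp_D root_r)
  have real_coeff: "(\<lambda>y. complex_of_real (real_periodic_coeff w D y)) = periodic_coeff w (of_real D)"
    by (simp add: fun_eq_iff real_periodic_coeff_eq)
  have period: "periodic_coeff w \<omega> (y + w) = periodic_coeff w \<omega> y" for \<omega> y
    using w_pos by (intro periodic_coeff_plus_period) simp
  show ?thesis
  proof (intro conjI allI impI)
    show "(\<lambda>x. orbit_psi N W x
               - (real_periodic_coeff w D (ln x) * x powr D - 1 / (real N - 1) * (\<Sum>j=1..N. W j)))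
          \<in> O[at_top](\<lambda>x. x powr (D - \<alpha>))" if "next_abscissa N W D (D - \<alpha>)" for \<alpha>
      using orbit_psi_asymptotics[OF reps0 that] .
    show "\<exists>\<alpha>. next_abscissa N W D (D - \<alpha>)" if "\<exists>\<omega>\<in>complex_dimensions N W. Re \<omega> < D"
      using next_abscissa_exists[OF that] .
    show "orbit_psi N W x = real_periodic_coeff w D (ln x) * x powr D - 1 / (real N - 1) * (\<Sum>j=1..N. W j)"
      if "\<not> (\<exists>\<omega>\<in>complex_dimensions N W. Re \<omega> < D)" "1 \<le> x" for x
      using orbit_psi_single_line[OF reps0 that] .
    show "real_periodic_coeff w D (y + w) = real_periodic_coeff w D y" for y
      using period[of "of_real D" y] unfolding real_periodic_coeff_eq[symmetric] by simp
    show "given_by_series w (of_real D) (\<lambda>y. of_real (real_periodic_coeff w D y))"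
      unfolding real_coeff by (rule given_by_series_periodic_coeff[OF w_pos exp_neq_1[OF D_dim]])
    show "\<exists>q \<omega>. dimension_reps N k w D q \<omega>" by (rule dimension_reps_exist)
  next
    fix q \<omega> assume reps: "dimension_reps N k w D q \<omega>"
    show "complex_dimensions N W = {shifted_dim w (\<omega> u) n | u n. u \<in> {1..q}}"
      by (rule complex_dimensions_reps[OF reps])
    show "zorder (dyn_zeta N W) (\<omega> 1) = - 1" by (rule zorder_at_D[OF reps])
    show "\<forall>u\<in>{1..q}. (\<forall>y. periodic_coeff w (\<omega> u) (y + w) = periodic_coeff w (\<omega> u) y)
        \<and> given_by_series w (\<omega> u) (periodic_coeff w (\<omega> u))"
      using period given_by_series_periodic_coeff[OF w_pos exp_neq_1[OF \<omega>_dimension[OF reps]]] by blast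
  next
    fix q \<omega> and x :: real assume reps: "dimension_reps N k w D q \<omega>" and x: "1 \<le> x"
    show "complex_of_real (orbit_psi N W x) =
                (\<Sum>u=1..q. - of_int (zorder (dyn_zeta N W) (\<omega> u))
                     * periodic_coeff w (\<omega> u) (ln x) * of_real x powr \<omega> u)
                - 1 / (of_nat N - 1) * (\<Sum>j=1..N. of_real (W j))"
      by (rule orbit_psi_explicit[OF reps x])
  next
    fix q \<omega> and x :: real assume reps: "dimension_reps N k w D q \<omega>" and x: "1 < x"
    show "\<exists>S l.
                (\<forall>u\<in>{1..q}. bilateral_sums
                   (\<lambda>n. of_real x powr shifted_dim w (\<omega> u) n / shifted_dim w (\<omega> u) n) (S u))
                \<and> (orbit_psi N W \<longlongrightarrow> l) (at_left x)
                \<and> (ln x / w \<notin> \<int> \<longrightarrow> l = orbit_psi N W x)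
                \<and> complex_of_real ((l + orbit_psi N W x) / 2) =
                     (\<Sum>u=1..q. - of_int (zorder (dyn_zeta N W) (\<omega> u)) * S u)
                     - 1 / (of_nat N - 1) * (\<Sum>j=1..N. of_real (W j))"
      by (rule orbit_psi_series[OF reps x])
  qed
qed

end
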